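(* Let $(H,g,\delta)$ be a generalized Einstein structure with non-zero divergence, $\delta\ne0$, on a three-dimensional non-unimodular real Lie algebra $\mathfrak g$. Then either (1) the unimodular kernel $\mathfrak u$ of $\mathfrak g$ is non-degenerate with respect to $g$, $\mathfrak g\cong\mathbb R\ltimes_A\mathbb R^2$ where $A=\begin{pmatrix}1&0\\0&\lambda\end{pmatrix}$ for some $\lambda\in(-1,1]$, and $H\ne0$; or (2) the unimodular kernel $\mathfrak u$ is degenerate with respect to $g$, $H=0$ and $\mathfrak g\cong\mathbb R\ltimes_A\mathbb R^2$, where $A\in\mathfrak{gl}(2,\mathbb R)$ has only real eigenvalues and $\mathrm{tr}\,A\neq0$; here $A$ can be arbitrary with these properties (i.e. for every such $A$ the Lie algebra $\mathbb R\ltimes_A\mathbb R^2$ admits a generalized Einstein structure of this kind).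
   Context: $\mathbb R\ltimes_A\mathbb R^2$ is the semidirect product Lie algebra in which the generator of $\mathbb R$ acts on the abelian ideal $\mathbb R^2$ by $A$. The unimodular kernel of $\mathfrak g$ is $\mathfrak u=\{X\in\mathfrak g:\mathrm{tr}\,\mathrm{ad}_X=0\}$; $\mathfrak g$ is unimodular if $\mathfrak u=\mathfrak g$. "$\mathfrak u$ is (non-)degenerate" means $g|_{\mathfrak u\times\mathfrak u}$ is (non-)degenerate. Let $E=\mathfrak g\oplus\mathfrak g^*$, with scalar product $\langle X+\xi,Y+\eta\rangle=\frac12(\xi(Y)+\eta(X))$. For $H\in\bigwedge^3\mathfrak g^*$ (automatically closed when $\dim\mathfrak g=3$) the Dorfman bracket is $[X+\xi,Y+\eta]_H=[X,Y]-\mathrm{ad}_X^*\eta+\mathrm{ad}_Y^*\xi+H(X,Y,\cdot)$, where $\mathrm{ad}_X^*\eta=\eta\circ\mathrm{ad}_X$. For a non-degenerate symmetric bilinear form $g$ on $\mathfrak g$ put $gX=g(X,\cdot)$ and $E_\pm=\{X\pm gX:X\in\mathfrak g\}$. A left-invariant generalized connection is a linear map $D:E\to\mathfrak{so}(E)$, $u\mapsto D_u$. Its torsion is $T(u,v)=D_uv-D_vu-[u,v]_H+(Du)^*v$, where $Du$ is $w\mapsto D_wu$ and $*$ is the adjoint for $\langle\cdot,\cdot\rangle$. $D$ is Levi-Civita if $T=0$ and $D_uE_\pm\subset E_\pm$ for all $u$. Its divergence is $\delta_D(v)=\mathrm{tr}(u\mapsto D_uv)$. Given $\delta\in E^*$,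 choose a Levi-Civita $D$ with $\delta_D=\delta$ (one exists), put $R(u,v)w=D_uD_vw-D_vD_uw-D_{[u,v]_H}w$ and, for $u_\pm\in E_\pm$, $Ric^+_\delta(u_-,u_+)=\mathrm{tr}(E_+\ni w\mapsto R(w,u_-)u_+\in E_+)$, $Ric^-_\delta(u_+,u_-)=\mathrm{tr}(E_-\ni w\mapsto R(w,u_+)u_-\in E_-)$; these are known to be independent of the choice of $D$. A generalized Einstein structure on $\mathfrak g$ is a triple $(H,g,\delta)$ with $H\in\bigwedge^3\mathfrak g^*$, $g\in\mathrm{Sym}^2\mathfrak g^*$ non-degenerate and $\delta\in E^*$ such that $Ric^+_\delta=0$ and $Ric^-_\delta=0$. *)

theory Defs
  imports "HOL-Analysis.Analysis"
begin

section \<open>Lie algebras\<close>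

text \<open>The underlying vector space of a real Lie algebra is a type of class
  \<^class>\<open>euclidean_space\<close>, which serves only as the class of (non-zero) finite-dimensional real
  vector spaces. The inner product of the type is not used: the metric of interest is a bilinear
  form of arbitrary signature.\<close>

definition lie_algebra :: "('a::euclidean_space \<Rightarrow> 'a \<Rightarrow> 'a) \<Rightarrow> bool" where
  "lie_algebra br \<longleftrightarrow> bilinear br \<and> (\<forall>x. br x x = 0) \<and>
     (\<forall>x y z. br x (br y z) + br y (br z x) + br z (br x y) = 0)"

definition lie_isomorphic ::
  "('a::euclidean_space \<Rightarrow> 'a \<Rightarrow> 'a) \<Rightarrow> ('b::euclidean_space \<Rightarrow> 'b \<Rightarrow> 'b) \<Rightarrow> bool" where
  "lie_isomorphic br1 br2 \<longleftrightarrow>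
     (\<exists>\<phi>. linear \<phi> \<and> bij \<phi> \<and> (\<forall>x y. \<phi> (br1 x y) = br2 (\<phi> x) (\<phi> y)))"

text \<open>Trace of an endomorphism \<open>f\<close> of a finite-dimensional subspace \<open>S\<close>, that is, the sum of the
  diagonal coefficients with respect to a basis of \<open>S\<close>. It is meaningful only if
  \<open>f\<close> is linear on \<open>S\<close> and maps \<open>S\<close> to itself.\<close>

definition endo_trace :: "'b::real_vector set \<Rightarrow> ('b \<Rightarrow> 'b) \<Rightarrow> real" where
  "endo_trace S f =
     (let B = (SOME B. independent B \<and> span B = S) in \<Sum>b\<in>B. representation B (f b) b)"

definition unimodular_kernel :: "('a::euclidean_space \<Rightarrow> 'a \<Rightarrow> 'a) \<Rightarrow> 'a set" where
  "unimodular_kernel br = {X. endo_trace UNIV (br X) = 0}"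

definition unimodular :: "('a::euclidean_space \<Rightarrow> 'a \<Rightarrow> 'a) \<Rightarrow> bool" where
  "unimodular br \<longleftrightarrow> unimodular_kernel br = UNIV"

text \<open>The bracket of the semidirect product of \<open>\<real>\<close> and the abelian ideal \<open>\<real>\<^sup>2\<close>, in which
  \<open>1 \<in> \<real>\<close> acts by \<open>A\<close>.\<close>

definition semidirect_bracket ::
  "real^2^2 \<Rightarrow> real \<times> (real^2) \<Rightarrow> real \<times> (real^2) \<Rightarrow> real \<times> (real^2)" where
  "semidirect_bracket A x y = (0, fst x *\<^sub>R (A *v snd y) - fst y *\<^sub>R (A *v snd x))"

definition only_real_eigenvalues :: "real^2^2 \<Rightarrow> bool" where
  "only_real_eigenvalues A \<longleftrightarrow>
     (\<forall>(\<mu>::complex) v. v \<noteq> 0 \<and> map_matrix complex_of_real A *v v = \<mu> *s v \<longrightarrow> \<mu> \<in> \<real>)"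

section \<open>Forms\<close>

definition nondegenerate_on :: "'a::real_vector set \<Rightarrow> ('a \<Rightarrow> 'a \<Rightarrow> real) \<Rightarrow> bool" where
  "nondegenerate_on S g \<longleftrightarrow> (\<forall>x\<in>S. (\<forall>y\<in>S. g x y = 0) \<longrightarrow> x = 0)"

definition pseudo_metric :: "('a::euclidean_space \<Rightarrow> 'a \<Rightarrow> real) \<Rightarrow> bool" where
  "pseudo_metric g \<longleftrightarrow> bilinear g \<and> (\<forall>x y. g x y = g y x) \<and> nondegenerate_on UNIV g"

definition alternating_3form :: "('a::euclidean_space \<Rightarrow> 'a \<Rightarrow> 'a \<Rightarrow> real) \<Rightarrow> bool" where
  "alternating_3form H \<longleftrightarrow>
     (\<forall>y z. linear (\<lambda>x. H x y z)) \<and> (\<forall>x z. linear (\<lambda>y. H x y z)) \<and> (\<forall>x y. linear (\<lambda>z. H x y z)) \<and>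
     (\<forall>x y. H x x y = 0 \<and> H x y x = 0 \<and> H y x x = 0)"

section \<open>The generalized tangent space\<close>

text \<open>In finite dimension every linear form is bounded, so \<open>'a \<Rightarrow>\<^sub>L real\<close> is the full dual
  space of \<open>'a\<close>, and \<^const>\<open>Blinfun\<close> applied to a linear form is that form as an element of the
  dual.\<close>

type_synonym 'a gen_tangent = "'a \<times> ('a \<Rightarrow>\<^sub>L real)"

definition pairing ::
  "'a::euclidean_space gen_tangent \<Rightarrow> 'a gen_tangent \<Rightarrow> real" where
  "pairing u v = (1/2) * (blinfun_apply (snd u) (fst v) + blinfun_apply (snd v) (fst u))"

definition coad :: "('a::euclidean_space \<Rightarrow> 'a \<Rightarrow> 'a) \<Rightarrow> 'a \<Rightarrow> ('a \<Rightarrow>\<^sub>L real) \<Rightarrow> ('a \<Rightarrow>\<^sub>L real)" where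
  "coad br X \<eta> = Blinfun (\<lambda>Z. blinfun_apply \<eta> (br X Z))"

definition dorfman ::
  "('a::euclidean_space \<Rightarrow> 'a \<Rightarrow> 'a) \<Rightarrow> ('a \<Rightarrow> 'a \<Rightarrow> 'a \<Rightarrow> real) \<Rightarrow>
   'a gen_tangent \<Rightarrow> 'a gen_tangent \<Rightarrow> 'a gen_tangent" where
  "dorfman br H u v =
     (br (fst u) (fst v),
      - coad br (fst u) (snd v) + coad br (fst v) (snd u) + Blinfun (\<lambda>Z. H (fst u) (fst v) Z))"

definition E_plus :: "('a::euclidean_space \<Rightarrow> 'a \<Rightarrow> real) \<Rightarrow> 'a gen_tangent set" where
  "E_plus g = range (\<lambda>X. (X, Blinfun (g X)))"

definition E_minus :: "('a::euclidean_space \<Rightarrow> 'a \<Rightarrow> real) \<Rightarrow> 'a gen_tangent set" where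
  "E_minus g = range (\<lambda>X. (X, - Blinfun (g X)))"

text \<open>Adjoint with respect to \<^const>\<open>pairing\<close>, defined in the same way as \<^const>\<open>adjoint\<close>
  for inner products.\<close>

definition pairing_adjoint ::
  "('a::euclidean_space gen_tangent \<Rightarrow> 'a gen_tangent) \<Rightarrow> 'a gen_tangent \<Rightarrow> 'a gen_tangent" where
  "pairing_adjoint f = (SOME f'. \<forall>u v. pairing (f u) v = pairing u (f' v))"

section \<open>Generalized connections and their curvature\<close>

definition gen_connection ::
  "('a::euclidean_space gen_tangent \<Rightarrow> 'a gen_tangent \<Rightarrow> 'a gen_tangent) \<Rightarrow> bool" where
  "gen_connection D \<longleftrightarrow> bilinear D \<and> (\<forall>u v w. pairing (D u v) w + pairing v (D u w) = 0)"

definition torsion ::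
  "('a::euclidean_space \<Rightarrow> 'a \<Rightarrow> 'a) \<Rightarrow> ('a \<Rightarrow> 'a \<Rightarrow> 'a \<Rightarrow> real) \<Rightarrow>
   ('a gen_tangent \<Rightarrow> 'a gen_tangent \<Rightarrow> 'a gen_tangent) \<Rightarrow>
   'a gen_tangent \<Rightarrow> 'a gen_tangent \<Rightarrow> 'a gen_tangent" where
  "torsion br H D u v =
     D u v - D v u - dorfman br H u v + pairing_adjoint (\<lambda>w. D w u) v"

definition levi_civita ::
  "('a::euclidean_space \<Rightarrow> 'a \<Rightarrow> 'a) \<Rightarrow> ('a \<Rightarrow> 'a \<Rightarrow> 'a \<Rightarrow> real) \<Rightarrow> ('a \<Rightarrow> 'a \<Rightarrow> real) \<Rightarrow>
   ('a gen_tangent \<Rightarrow> 'a gen_tangent \<Rightarrow> 'a gen_tangent) \<Rightarrow> bool" where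
  "levi_civita br H g D \<longleftrightarrow> gen_connection D \<and> (\<forall>u v. torsion br H D u v = 0) \<and>
     (\<forall>u. D u ` E_plus g \<subseteq> E_plus g \<and> D u ` E_minus g \<subseteq> E_minus g)"

definition divergence ::
  "('a::euclidean_space gen_tangent \<Rightarrow> 'a gen_tangent \<Rightarrow> 'a gen_tangent) \<Rightarrow>
   'a gen_tangent \<Rightarrow> real" where
  "divergence D v = endo_trace UNIV (\<lambda>u. D u v)"

definition curvature ::
  "('a::euclidean_space \<Rightarrow> 'a \<Rightarrow> 'a) \<Rightarrow> ('a \<Rightarrow> 'a \<Rightarrow> 'a \<Rightarrow> real) \<Rightarrow>
   ('a gen_tangent \<Rightarrow> 'a gen_tangent \<Rightarrow> 'a gen_tangent) \<Rightarrow>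
   'a gen_tangent \<Rightarrow> 'a gen_tangent \<Rightarrow> 'a gen_tangent \<Rightarrow> 'a gen_tangent" where
  "curvature br H D u v w = D u (D v w) - D v (D u w) - D (dorfman br H u v) w"

text \<open>A choice of Levi-Civita generalized connection with divergence \<open>\<delta>\<close>. One exists for every
  linear \<open>\<delta>\<close> when the dimension is at least two, and the Ricci curvatures below do not depend on
  the choice.\<close>

definition lc_connection ::
  "('a::euclidean_space \<Rightarrow> 'a \<Rightarrow> 'a) \<Rightarrow> ('a \<Rightarrow> 'a \<Rightarrow> 'a \<Rightarrow> real) \<Rightarrow> ('a \<Rightarrow> 'a \<Rightarrow> real) \<Rightarrow>
   ('a gen_tangent \<Rightarrow> real) \<Rightarrow> 'a gen_tangent \<Rightarrow> 'a gen_tangent \<Rightarrow> 'a gen_tangent" where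
  "lc_connection br H g \<delta> = (SOME D. levi_civita br H g D \<and> divergence D = \<delta>)"

definition ricci_plus ::
  "('a::euclidean_space \<Rightarrow> 'a \<Rightarrow> 'a) \<Rightarrow> ('a \<Rightarrow> 'a \<Rightarrow> 'a \<Rightarrow> real) \<Rightarrow> ('a \<Rightarrow> 'a \<Rightarrow> real) \<Rightarrow>
   ('a gen_tangent \<Rightarrow> real) \<Rightarrow> 'a gen_tangent \<Rightarrow> 'a gen_tangent \<Rightarrow> real" where
  "ricci_plus br H g \<delta> um up =
     endo_trace (E_plus g) (\<lambda>w. curvature br H (lc_connection br H g \<delta>) w um up)"

definition ricci_minus ::
  "('a::euclidean_space \<Rightarrow> 'a \<Rightarrow> 'a) \<Rightarrow> ('a \<Rightarrow> 'a \<Rightarrow> 'a \<Rightarrow> real) \<Rightarrow> ('a \<Rightarrow> 'a \<Rightarrow> real) \<Rightarrow>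
   ('a gen_tangent \<Rightarrow> real) \<Rightarrow> 'a gen_tangent \<Rightarrow> 'a gen_tangent \<Rightarrow> real" where
  "ricci_minus br H g \<delta> up um =
     endo_trace (E_minus g) (\<lambda>w. curvature br H (lc_connection br H g \<delta>) w up um)"

text \<open>Closedness of \<open>H\<close> is not required separately because it is automatic in dimension three,
  the only dimension in which this definition is used.\<close>

definition gen_einstein ::
  "('a::euclidean_space \<Rightarrow> 'a \<Rightarrow> 'a) \<Rightarrow> ('a \<Rightarrow> 'a \<Rightarrow> 'a \<Rightarrow> real) \<Rightarrow> ('a \<Rightarrow> 'a \<Rightarrow> real) \<Rightarrow>
   ('a gen_tangent \<Rightarrow> real) \<Rightarrow> bool" where
  "gen_einstein br H g \<delta> \<longleftrightarrow>
     alternating_3form H \<and> pseudo_metric g \<and> linear \<delta> \<and>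
     (\<forall>um\<in>E_minus g. \<forall>up\<in>E_plus g. ricci_plus br H g \<delta> um up = 0) \<and>
     (\<forall>up\<in>E_plus g. \<forall>um\<in>E_minus g. ricci_minus br H g \<delta> up um = 0)"

end

theory Submission
  imports Defs
begin

text \<open>
  Write \<open>\<nabla>\<^sup>\<plusminus> = \<nabla> \<plusminus> H/2\<close> for the metric connections of \<open>g\<close> with torsion \<open>\<plusminus>H\<close>. Vanishing torsion
  forces the mixed parts of every Levi-Civita generalized connection to be \<open>\<nabla>\<^sup>+\<close> and
  \<open>\<nabla>\<^sup>-\<close>, and in the trace defining the Ricci curvature the undetermined pure part enters only
  through its divergence, so that the Einstein equations read
  \<open>\<delta>(\<nabla>\<^sup>+\<^sub>X Y \<oplus> g \<nabla>\<^sup>+\<^sub>X Y) = tr (W \<mapsto> \<nabla>\<^sup>+\<^bsub>\<nabla>\<^sup>-\<^sub>W X\<^esub> Y)\<close> together with the same equation for \<open>-g\<close>, which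
  exchanges \<open>\<nabla>\<^sup>+\<close> and \<open>\<nabla>\<^sup>-\<close> as well as the two eigenbundles.

  A three-dimensional non-unimodular Lie algebra is \<open>\<real> \<ltimes>\<^sub>A \<real>\<^sup>2\<close> with \<open>\<real>\<^sup>2\<close> its unimodular kernel, which
  is the \<open>g\<close>-orthogonal complement of the vector \<open>n\<close> representing \<open>X \<mapsto> tr ad\<^sub>X\<close>. If \<open>n\<close> is not null,
  an orthogonal frame starting with \<open>n\<close> turns the equations into polynomial identities: \<open>H = 0\<close>
  forces \<open>\<delta> = 0\<close>, and otherwise they make \<open>A\<close> real diagonalizable. If \<open>n\<close> is null, a null frame
  containing \<open>n\<close> yields \<open>H = 0\<close> and that \<open>n\<close> is an eigenvector of \<open>A\<close>. Conversely, for triangular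
  \<open>A\<close> with first eigenvalue non-zero, the null frame solves the equations with \<open>H = 0\<close> and a divergence
  supported on the direction transversal to the kernel.
\<close>

section \<open>Traces\<close>

text \<open>On \<open>S\<close> the map \<open>f\<close> is the sum of the rank one maps
  \<open>x\<close> to \<open>k i x *\<^sub>R f (c i)\<close>, whose traces are
  \<open>k i (f (c i))\<close>. This frees the trace from the basis chosen in its
  definition.\<close>

lemma endo_trace_eq_sum:
  fixes f :: "'b::real_vector \<Rightarrow> 'b"
  assumes "finite I" and S: "subspace S" and cS: "\<And>i. i \<in> I \<Longrightarrow> c i \<in> S"
    and k: "\<And>i. i \<in> I \<Longrightarrow> linear (k i)"
    and exp: "\<And>x. x \<in> S \<Longrightarrow> x = (\<Sum>i\<in>I. k i x *\<^sub>R c i)"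
    and f: "linear f" and fS: "\<And>x. x \<in> S \<Longrightarrow> f x \<in> S"
  shows "endo_trace S f = (\<Sum>i\<in>I. k i (f (c i)))"
proof -
  define B where "B = (SOME B. independent B \<and> span B = S)"
  have "\<exists>B. independent B \<and> span B = S"
    using basis_exists[of S] S by (metis span_subspace)
  then have B: "independent B" "span B = S"
    unfolding B_def by (metis (mono_tags, lifting) someI_ex)+
  have "B \<subseteq> span (c ` I)"
  proof
    fix b assume "b \<in> B"
    then have "b = (\<Sum>i\<in>I. k i b *\<^sub>R c i)" using B exp span_base by blast
    also have "\<dots> \<in> span (c ` I)"
      by (intro span_sum span_scale span_base) auto
    finally show "b \<in> span (c ` I)" .
  qed
  then have fin: "finite B"
    using independent_span_bound[of "c ` I" B] B(1) assms(1) by auto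
  have BS: "b \<in> S" if "b \<in> B" for b using that B(2) span_base by blast
  have rlin: "representation B (\<Sum>i\<in>I. a i *\<^sub>R f (c i)) b = (\<Sum>i\<in>I. a i * representation B (f (c i)) b)" for a b
  proof -
    have "representation B (\<Sum>i\<in>I. a i *\<^sub>R f (c i)) = (\<lambda>b. \<Sum>i\<in>I. representation B (a i *\<^sub>R f (c i)) b)"
      by (rule representation_sum[OF B(1)]) (metis B(2) cS fS span_scale)
    then show ?thesis
      using representation_scale[OF B(1)] B(2) cS fS by (auto intro!: sum.cong)
  qed
  have fb: "f b = (\<Sum>i\<in>I. k i b *\<^sub>R f (c i))" if "b \<in> B" for b
    using exp[OF BS[OF that]] linear_sum[OF f, of "\<lambda>i. k i b *\<^sub>R c i" I] linear_scale[OF f] by (metis (no_types, lifting) sum.cong)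
  have "endo_trace S f = (\<Sum>b\<in>B. representation B (f b) b)"
    unfolding endo_trace_def B_def Let_def ..
  also have "\<dots> = (\<Sum>b\<in>B. \<Sum>i\<in>I. k i b * representation B (f (c i)) b)"
    by (intro sum.cong refl) (simp add: fb rlin)
  also have "\<dots> = (\<Sum>i\<in>I. \<Sum>b\<in>B. representation B (f (c i)) b * k i b)"
    by (subst sum.swap) (simp add: mult.commute)
  also have "\<dots> = (\<Sum>i\<in>I. k i (\<Sum>b\<in>B. representation B (f (c i)) b *\<^sub>R b))"
    by (intro sum.cong refl) (simp add: linear_sum[OF k] linear_scale[OF k])
  also have "\<dots> = (\<Sum>i\<in>I. k i (f (c i)))"
    using sum_representation_eq[OF B(1) _ fin subset_refl] B(2) cS fS by (intro sum.cong refl) auto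
  finally show ?thesis .
qed

lemma endo_trace_UNIV:
  fixes f :: "'a::euclidean_space \<Rightarrow> 'a"
  assumes "linear f"
  shows "endo_trace UNIV f = (\<Sum>b\<in>Basis. f b \<bullet> b)"
  by (rule endo_trace_eq_sum[where k="\<lambda>b x. x \<bullet> b"])
    (auto simp: assms euclidean_representation bounded_linear.linear[OF bounded_linear_inner_left])

lemma endo_trace_add:
  fixes f h :: "'a::euclidean_space \<Rightarrow> 'a"
  assumes "linear f" "linear h"
  shows "endo_trace UNIV (\<lambda>x. f x + h x) = endo_trace UNIV f + endo_trace UNIV h"
  by (simp add: endo_trace_UNIV assms linear_compose_add inner_add_left sum.distrib)

lemma endo_trace_diff:
  fixes f h :: "'a::euclidean_space \<Rightarrow> 'a"
  assumes "linear f" "linear h"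
  shows "endo_trace UNIV (\<lambda>x. f x - h x) = endo_trace UNIV f - endo_trace UNIV h"
  by (simp add: endo_trace_UNIV assms linear_compose_sub inner_diff_left sum_subtractf)

lemma endo_trace_scaleR:
  fixes f :: "'a::euclidean_space \<Rightarrow> 'a"
  assumes "linear f"
  shows "endo_trace UNIV (\<lambda>x. r *\<^sub>R f x) = r * endo_trace UNIV f"
  by (simp add: endo_trace_UNIV assms linear_compose_scale_right sum_distrib_left)

lemma endo_trace_commute:
  fixes f h :: "'a::euclidean_space \<Rightarrow> 'a"
  assumes f: "linear f" and h: "linear h"
  shows "endo_trace UNIV (\<lambda>x. f (h x)) = endo_trace UNIV (\<lambda>x. h (f x))"
proof -
  have *: "f (h b) \<bullet> b = (\<Sum>c\<in>Basis. (h b \<bullet> c) * (f c \<bullet> b))" if "linear f" "linear h"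
    for f h and b :: 'a
    by (subst euclidean_representation[of "h b", symmetric])
      (simp add: linear_sum[OF that(1)] linear_scale[OF that(1)] inner_sum_left del: euclidean_representation)
  then show ?thesis
    using linear_compose[OF f h] linear_compose[OF h f] f h
      sum.swap[of "\<lambda>b c. (h b \<bullet> c) * (f c \<bullet> b)" Basis Basis]
    by (simp add: endo_trace_UNIV o_def mult.commute *[OF f h] *[OF h f])
qed

lemma bilinear_alternating_skew:
  assumes h: "bilinear h" "\<And>x. h x x = 0"
  shows "h y x = - h x y"
proof -
  have "h (x + y) (x + y) = h x y + h y x"
    unfolding bilinear_ladd[OF h(1)] bilinear_radd[OF h(1)] by (simp add: h(2))
  then have "h x y + h y x = 0" unfolding h(2) by (rule sym)
  then show ?thesis by (simp add: eq_neg_iff_add_eq_0 add.commute)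
qed

section \<open>The splitting of the generalized tangent space\<close>

text \<open>The parametrization of \<open>E_plus g\<close> by its vector part; with
  \<open>neg g\<close> in place of \<open>g\<close> it parametrizes
  \<open>E_minus g\<close>.\<close>

definition lift :: "('a::euclidean_space \<Rightarrow> 'a \<Rightarrow> real) \<Rightarrow> 'a \<Rightarrow> 'a gen_tangent" where
  "lift g X = (X, Blinfun (g X))"

definition neg :: "('a \<Rightarrow> 'a \<Rightarrow> real) \<Rightarrow> 'a \<Rightarrow> 'a \<Rightarrow> real" where
  "neg g X Y = - g X Y"

lemma neg_neg [simp]: "neg (neg g) = g"
  by (simp add: neg_def fun_eq_iff)

lemma Blinfun_apply_linear:
  fixes f :: "'a::euclidean_space \<Rightarrow> real"
  shows "linear f \<Longrightarrow> blinfun_apply (Blinfun f) = f"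
  by (simp add: bounded_linear_Blinfun_apply linear_conv_bounded_linear)

text \<open>Koszul's formula for left-invariant fields with \<open>H / 2\<close> added: the metric
  connection with torsion \<open>H\<close>. For \<open>neg g\<close> the sign of \<open>H\<close>
  relative to the metric changes, which gives the connection with torsion \<open>-H\<close>.\<close>

definition nabla ::
  "('a::euclidean_space \<Rightarrow> 'a \<Rightarrow> 'a) \<Rightarrow> ('a \<Rightarrow> 'a \<Rightarrow> 'a \<Rightarrow> real) \<Rightarrow> ('a \<Rightarrow> 'a \<Rightarrow> real) \<Rightarrow> 'a \<Rightarrow> 'a \<Rightarrow> 'a" where
  "nabla br H g X Y =
     (THE Z. \<forall>W. g Z W = (g (br X Y) W - g X (br Y W) - g Y (br X W) + H X Y W) / 2)"

locale gen_metric =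
  fixes br :: "'a::euclidean_space \<Rightarrow> 'a \<Rightarrow> 'a" and H :: "'a \<Rightarrow> 'a \<Rightarrow> 'a \<Rightarrow> real"
    and g :: "'a \<Rightarrow> 'a \<Rightarrow> real"
  assumes br_bilinear: "bilinear br" and br_self [simp]: "br x x = 0"
    and H_alt: "alternating_3form H" and g_metric: "pseudo_metric g"
begin

abbreviation "g' \<equiv> neg g"
abbreviation "N \<equiv> nabla br H g"
abbreviation "N' \<equiv> nabla br H g'"

lemma g_bilinear: "bilinear g" and g_sym: "g x y = g y x"
  and g_nondeg: "(\<And>y. g x y = 0) \<Longrightarrow> x = 0"
  using g_metric by (auto simp: pseudo_metric_def nondegenerate_on_def)

lemmas g_simps = bilinear_ladd[OF g_bilinear] bilinear_radd[OF g_bilinear]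
  bilinear_lsub[OF g_bilinear] bilinear_rsub[OF g_bilinear]
  bilinear_lmul[OF g_bilinear] bilinear_rmul[OF g_bilinear]
  bilinear_lneg[OF g_bilinear] bilinear_rneg[OF g_bilinear]
  bilinear_lzero[OF g_bilinear] bilinear_rzero[OF g_bilinear]

lemmas br_simps = bilinear_ladd[OF br_bilinear] bilinear_radd[OF br_bilinear]
  bilinear_lsub[OF br_bilinear] bilinear_rsub[OF br_bilinear]
  bilinear_lmul[OF br_bilinear] bilinear_rmul[OF br_bilinear]
  bilinear_lneg[OF br_bilinear] bilinear_rneg[OF br_bilinear]
  bilinear_lzero[OF br_bilinear] bilinear_rzero[OF br_bilinear]

lemma H_linear: "linear (\<lambda>x. H x y z)" "linear (\<lambda>y. H x y z)" "linear (\<lambda>z. H x y z)"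
  using H_alt by (auto simp: alternating_3form_def)

lemmas H_simps = H_linear[THEN linear_add] H_linear[THEN linear_diff] H_linear[THEN linear_scale]
  H_linear[THEN linear_0] H_linear[THEN linear_neg]

lemma H_self [simp]: "H x x y = 0" "H x y x = 0" "H y x x = 0"
  using H_alt by (auto simp: alternating_3form_def)

lemma br_skew: "br y x = - br x y"
  by (rule bilinear_alternating_skew[OF br_bilinear br_self])

lemma H_skew12: "H y x z = - H x y z"
proof -
  have "H (x + y) (x + y) z = H x y z + H y x z" unfolding H_simps by simp
  then show ?thesis by simp
qed

lemma H_skew23: "H x z y = - H x y z"
proof -
  have "H x (y + z) (y + z) = H x y z + H x z y" unfolding H_simps by simp
  then show ?thesis by simp
qed

text \<open>The symmetry that exchanges \<open>E_plus\<close> with \<open>E_minus\<close> and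
  \<open>N\<close> with \<open>N'\<close>; statements about one eigenbundle are transported to the
  other by it.\<close>

lemma gen_metric_neg: "gen_metric br H g'"
  using br_bilinear H_alt g_metric
  by unfold_locales
    (auto simp: pseudo_metric_def nondegenerate_on_def neg_def bilinear_def
      intro: linear_compose_neg)

text \<open>The Euclidean inner product only serves to turn \<open>g\<close> into an endomorphism
  \<open>G\<close>. Non-degeneracy makes \<open>G\<close> injective, hence surjective by
  dimension.\<close>

lemma riesz:
  assumes "linear \<phi>"
  shows "\<exists>!Z. \<forall>W. g Z W = \<phi> W"
proof -
  define G where "G X = (\<Sum>b\<in>Basis. g X b *\<^sub>R b)" for X
  have G: "G X \<bullet> W = g X W" for X W
  proof -
    have "linear (g X)" using g_bilinear by (simp add: bilinear_def)
    then have "g X W = (\<Sum>b\<in>Basis. (W \<bullet> b) * g X b)"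
      using linear_sum[of "g X" "\<lambda>b. (W \<bullet> b) *\<^sub>R b" Basis] linear_scale[of "g X"]
      by (simp add: euclidean_representation)
    then show ?thesis by (simp add: G_def inner_sum_right inner_commute[of _ W] mult.commute)
  qed
  have "linear G"
    by (auto simp: linear_iff G_def g_simps scaleR_add_left sum.distrib scaleR_sum_right)
  moreover have "inj G"
    using \<open>linear G\<close> by (simp add: linear_injective_0) (metis G g_nondeg inner_zero_left)
  ultimately have "surj G" using linear_injective_imp_surjective by blast
  then obtain Z where Z: "G Z = (\<Sum>b\<in>Basis. \<phi> b *\<^sub>R b)" by (metis surjD)
  have "g Z W = \<phi> W" for W
  proof -
    have "\<phi> W = (\<Sum>b\<in>Basis. (W \<bullet> b) * \<phi> b)"
      using linear_sum[OF assms, of "\<lambda>b. (W \<bullet> b) *\<^sub>R b" Basis] linear_scale[OF assms]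
      by (simp add: euclidean_representation)
    then show ?thesis by (simp flip: G add: Z inner_sum_right inner_commute[of _ W] mult.commute)
  qed
  moreover have "Z1 = Z2" if "\<And>W. g Z1 W = \<phi> W" "\<And>W. g Z2 W = \<phi> W" for Z1 Z2
    using g_nondeg[of "Z1 - Z2"] that by (simp add: g_simps)
  ultimately show ?thesis by metis
qed

lemma g_eqI: "(\<And>W. g X W = g Y W) \<Longrightarrow> X = Y"
  using g_nondeg[of "X - Y"] by (simp add: g_simps)

lemma g_nabla: "g (N X Y) W = (g (br X Y) W - g X (br Y W) - g Y (br X W) + H X Y W) / 2"
proof -
  have "linear (\<lambda>W. (g (br X Y) W - g X (br Y W) - g Y (br X W) + H X Y W) / 2)"
    by (auto simp: linear_iff g_simps br_simps H_simps field_simps)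
  from theI'[OF riesz[OF this]] show ?thesis unfolding nabla_def by blast
qed

lemma g_nabla': "g (N' X Y) W = (g (br X Y) W - g X (br Y W) - g Y (br X W) - H X Y W) / 2"
  using gen_metric.g_nabla[OF gen_metric_neg, of X Y W] by (simp add: neg_def field_simps)

lemma nabla_bilinear: "bilinear N"
  unfolding bilinear_def linear_iff
  by (auto intro!: g_eqI simp: g_simps g_nabla br_simps H_simps field_simps)

lemma lift_apply: "blinfun_apply (snd (lift g X)) Y = g X Y" "fst (lift g X) = X"
  using g_bilinear by (auto simp: lift_def bilinear_def Blinfun_apply_linear)

lemma lift'_apply: "blinfun_apply (snd (lift g' X)) Y = - g X Y" "fst (lift g' X) = X"
  using gen_metric.lift_apply[OF gen_metric_neg] by (simp_all add: neg_def[of g])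

lemma gen_tangent_eqI:
  "fst u = fst v \<Longrightarrow> (\<And>Z. blinfun_apply (snd u) Z = blinfun_apply (snd v) Z) \<Longrightarrow> u = v"
  for u v :: "'a gen_tangent"
  by (auto intro!: prod_eqI blinfun_eqI)

lemma lift_linear: "linear (lift g)"
  unfolding linear_iff
  by (auto intro!: gen_tangent_eqI simp: lift_apply g_simps blinfun.bilinear_simps)

lemma E_plus_lift: "E_plus g = range (lift g)"
  by (simp add: E_plus_def lift_def)

lemma E_minus_lift: "E_minus g = range (lift g')"
proof -
  have "lift g' X = (X, - Blinfun (g X))" for X
  proof (rule gen_tangent_eqI)
    show "blinfun_apply (snd (lift g' X)) Z = blinfun_apply (snd (X, - Blinfun (g X))) Z" for Z
      using lift_apply(1)[of X Z] lift'_apply(1)[of X Z]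
      by (simp add: blinfun.bilinear_simps) (simp add: lift_def)
  qed (simp add: lift_def)
  then show ?thesis by (simp add: E_minus_def)
qed

lemma E_plus_neg: "E_plus g' = E_minus g" "E_minus g' = E_plus g"
  using gen_metric.E_minus_lift[OF gen_metric_neg] gen_metric.E_plus_lift[OF gen_metric_neg]
  by (simp_all add: E_minus_lift E_plus_lift)

lemma pairing_lift:
  "pairing (lift g X) (lift g Y) = g X Y" "pairing (lift g' X) (lift g' Y) = - g X Y"
  "pairing (lift g X) (lift g' Y) = 0" "pairing (lift g' X) (lift g Y) = 0"
  by (auto simp: pairing_def lift_apply lift'_apply g_sym[of Y X])

lemma pairing_bilinear: "bilinear (pairing :: 'a gen_tangent \<Rightarrow> _)"
  by (auto simp: bilinear_def linear_iff pairing_def blinfun.bilinear_simps field_simps)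

lemmas pairing_simps = bilinear_ladd[OF pairing_bilinear] bilinear_radd[OF pairing_bilinear]
  bilinear_lsub[OF pairing_bilinear] bilinear_rsub[OF pairing_bilinear]
  bilinear_lneg[OF pairing_bilinear] bilinear_rneg[OF pairing_bilinear]
  bilinear_lmul[OF pairing_bilinear] bilinear_rmul[OF pairing_bilinear]
  bilinear_lzero[OF pairing_bilinear] bilinear_rzero[OF pairing_bilinear]

text \<open>The coordinates of an element of the generalized tangent space with respect to the
  splitting into \<^const>\<open>E_plus\<close> and \<^const>\<open>E_minus\<close>.\<close>

definition part_plus :: "'a gen_tangent \<Rightarrow> 'a" where
  "part_plus u = (THE Z. \<forall>W. g Z W = pairing u (lift g W))"

definition part_minus :: "'a gen_tangent \<Rightarrow> 'a" where
  "part_minus u = (THE Z. \<forall>W. g Z W = - pairing u (lift g' W))"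

lemma g_part_plus: "g (part_plus u) W = pairing u (lift g W)"
proof -
  have "linear (\<lambda>W. pairing u (lift g W))"
    using pairing_bilinear linear_compose[OF lift_linear] unfolding bilinear_def o_def by blast
  from theI'[OF riesz[OF this]] show ?thesis unfolding part_plus_def by blast
qed

lemma g_part_minus: "g (part_minus u) W = - pairing u (lift g' W)"
proof -
  have "linear (\<lambda>W. - pairing u (lift g' W))"
    using pairing_bilinear linear_compose[OF gen_metric.lift_linear[OF gen_metric_neg]]
    unfolding bilinear_def o_def by (blast intro: linear_compose_neg)
  from theI'[OF riesz[OF this]] show ?thesis unfolding part_minus_def by blast
qed

lemma pairing_eqI:
  assumes "\<And>W. pairing u (lift g W) = pairing v (lift g W)"
    and "\<And>W. pairing u (lift g' W) = pairing v (lift g' W)"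
  shows "u = v"
proof (rule gen_tangent_eqI)
  \<comment> \<open>The difference of the two hypotheses determines the vector part, their sum the
    form part.\<close>
  show "fst u = fst v"
    using assms by (intro g_eqI) (simp add: pairing_def lift_apply lift'_apply g_sym[of "fst _"], smt (verit))
  show "blinfun_apply (snd u) Z = blinfun_apply (snd v) Z" for Z
    using assms[of Z] by (simp add: pairing_def lift_apply lift'_apply)
qed

lemma lift_parts: "u = lift g (part_plus u) + lift g' (part_minus u)"
  by (rule pairing_eqI) (simp_all add: pairing_simps pairing_lift g_part_plus g_part_minus)

lemma part_lift [simp]: "part_plus (lift g X) = X" "part_minus (lift g X) = 0"
  "part_plus (lift g' X) = 0" "part_minus (lift g' X) = X"
  by (auto intro!: g_eqI simp: g_part_plus g_part_minus pairing_lift g_simps)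

lemma part_linear: "linear part_plus" "linear part_minus"
  by (intro linearI g_eqI; simp add: g_part_plus g_part_minus g_simps pairing_simps)+

text \<open>Makes the choice in the definition of \<open>pairing_adjoint\<close> meaningful. An
  adjoint is built from Riesz representatives on the two eigenbundles; the pairing is
  \<open>-g\<close> on \<open>E_minus\<close>, whence the sign in \<open>lin'\<close>.\<close>

lemma pairing_adjoint:
  fixes f :: "'a gen_tangent \<Rightarrow> 'a gen_tangent"
  assumes "linear f"
  shows "pairing (f u) v = pairing u (pairing_adjoint f v)"
proof -
  note lift'_linear = gen_metric.lift_linear[OF gen_metric_neg]
  have lin: "linear (\<lambda>X. pairing (f (lift g X)) v)" for v
    by (rule linearI) (simp_all only: pairing_simps linear_add[OF assms] linear_scale[OF assms]
        linear_add[OF lift_linear] linear_scale[OF lift_linear] real_scaleR_def)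
  have lin': "linear (\<lambda>X. - pairing (f (lift g' X)) v)" for v
    by (rule linearI) (simp_all add: pairing_simps linear_add[OF assms] linear_scale[OF assms]
        linear_add[OF lift'_linear] linear_scale[OF lift'_linear])
  have "\<exists>w. \<forall>u. pairing (f u) v = pairing u w" for v
  proof -
    obtain P where P: "\<And>W. g P W = pairing (f (lift g W)) v"
      using riesz[OF lin] by metis
    obtain M where M: "\<And>W. g M W = - pairing (f (lift g' W)) v"
      using riesz[OF lin'] by metis
    have "pairing (f u) v = pairing u (lift g P + lift g' M)" for u
    proof -
      have "pairing (f (lift g p + lift g' m)) v = pairing (lift g p + lift g' m) (lift g P + lift g' M)" for p m
        using P[of p] M[of m]
        by (simp add: pairing_simps pairing_lift linear_add[OF assms] g_sym[of p] g_sym[of m])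
      then show ?thesis by (metis lift_parts)
    qed
    then show ?thesis by blast
  qed
  then have "\<exists>f'. \<forall>u v. pairing (f u) v = pairing u (f' v)" by metis
  from someI_ex[OF this] show ?thesis unfolding pairing_adjoint_def by blast
qed

lemma dorfman_snd:
  "blinfun_apply (snd (dorfman br H u v)) Z =
     - blinfun_apply (snd v) (br (fst u) Z) + blinfun_apply (snd u) (br (fst v) Z) + H (fst u) (fst v) Z"
proof -
  have "linear (\<lambda>Z. blinfun_apply \<eta> (br X Z))" for \<eta> :: "'a \<Rightarrow>\<^sub>L real" and X
    by (auto simp: linear_iff br_simps blinfun.bilinear_simps)
  then show ?thesis
    using H_linear(3)
    by (simp add: dorfman_def coad_def blinfun.bilinear_simps Blinfun_apply_linear)
qed

text \<open>The source of both connections: the two components of a mixed bracket are Koszul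
  formulas, with opposite signs of \<open>H\<close>.\<close>

lemma dorfman_lift: "dorfman br H (lift g W) (lift g' X) = lift g' (N' W X) - lift g (N X W)"
proof (rule gen_tangent_eqI)
  show "fst (dorfman br H (lift g W) (lift g' X)) = fst (lift g' (N' W X) - lift g (N X W))"
    by (intro g_eqI)
      (simp add: dorfman_def lift_apply lift'_apply g_simps g_nabla g_nabla' br_skew[of W X] H_skew12[of W X] field_simps)
  show "blinfun_apply (snd (dorfman br H (lift g W) (lift g' X))) Z =
      blinfun_apply (snd (lift g' (N' W X) - lift g (N X W))) Z" for Z
    by (simp add: dorfman_snd lift_apply lift'_apply g_nabla g_nabla' blinfun.bilinear_simps
        g_simps br_skew[of W X] H_skew12[of W X] field_simps)
qed

end

section \<open>Levi-Civita generalized connections and Ricci curvature\<close>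

context gen_metric
begin

lemma pairing_sym: "pairing u v = pairing v u" for u v :: "'a gen_tangent"
  by (simp add: pairing_def)

lemma pairing_parts: "pairing u v = g (part_plus u) (part_plus v) - g (part_minus u) (part_minus v)"
proof -
  have "pairing (lift g a + lift g' b) (lift g c + lift g' d) = g a c - g b d" for a b c d
    by (simp add: pairing_simps pairing_lift)
  then show ?thesis by (metis lift_parts)
qed

lemma levi_civita_neg: "levi_civita br H g' D \<longleftrightarrow> levi_civita br H g D"
  unfolding levi_civita_def E_plus_neg by blast

text \<open>Pair the vanishing torsion of an element of \<open>E_minus\<close> and one of
  \<open>E_plus\<close> with a third one in \<open>E_plus\<close>. The term \<open>D v u\<close> and
  the adjoint term drop out because \<open>D\<close> preserves the orthogonal eigenbundles, so the
  mixed derivative is the \<open>E_plus\<close> part of the bracket.\<close>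

lemma levi_civita_mixed:
  assumes D: "levi_civita br H g D"
  shows "D (lift g' X) (lift g Y) = lift g (N X Y)"
proof -
  have bil: "bilinear D" and tor: "torsion br H D u v = 0" for u v
    using D unfolding levi_civita_def gen_connection_def by blast+
  obtain Z where Z: "D (lift g' X) (lift g Y) = lift g Z"
    using D unfolding levi_civita_def E_plus_lift by blast
  have "g Z W = g (N X Y) W" for W
  proof -
    obtain V where V: "D (lift g W) (lift g' X) = lift g' V"
      using D unfolding levi_civita_def E_minus_lift by blast
    obtain U where U: "D (lift g Y) (lift g' X) = lift g' U"
      using D unfolding levi_civita_def E_minus_lift by blast
    have "linear (\<lambda>w. D w (lift g' X))" using bil unfolding bilinear_def by blast
    from pairing_adjoint[OF this, of "lift g W" "lift g Y"]
    have "pairing (pairing_adjoint (\<lambda>w. D w (lift g' X)) (lift g Y)) (lift g W) = 0"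
      by (simp add: V pairing_lift pairing_sym[of _ "lift g W"])
    moreover have "pairing (torsion br H D (lift g' X) (lift g Y)) (lift g W) = 0"
      by (simp add: tor pairing_simps)
    ultimately show ?thesis
      using gen_metric.dorfman_lift[OF gen_metric_neg, of X Y]
      by (simp add: torsion_def pairing_simps pairing_lift Z U)
  qed
  then show ?thesis using Z g_eqI by blast
qed

lemma endo_trace_E_plus:
  assumes F: "linear F" and h: "linear h" and Fh: "\<And>W. F (lift g W) = lift g (h W)"
  shows "endo_trace (E_plus g) F = endo_trace UNIV h"
proof -
  have "endo_trace (E_plus g) F = (\<Sum>b\<in>Basis. part_plus (F (lift g b)) \<bullet> b)"
  proof (rule endo_trace_eq_sum[where k = "\<lambda>b u. part_plus u \<bullet> b"])
    show "subspace (E_plus g)"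
      unfolding E_plus_lift using linear_subspace_image[OF lift_linear] by simp
    show "linear (\<lambda>u. part_plus u \<bullet> b)" for b
      by (rule linearI) (simp_all add: linear_add[OF part_linear(1)] linear_scale[OF part_linear(1)] inner_add_left)
    show "x = (\<Sum>b\<in>Basis. (part_plus x \<bullet> b) *\<^sub>R lift g b)" if "x \<in> E_plus g" for x
    proof -
      obtain X where X: "x = lift g X" using \<open>x \<in> E_plus g\<close> by (auto simp: E_plus_lift)
      have "lift g (\<Sum>b\<in>Basis. (X \<bullet> b) *\<^sub>R b) = (\<Sum>b\<in>Basis. (X \<bullet> b) *\<^sub>R lift g b)"
        by (simp only: linear_sum[OF lift_linear] linear_scale[OF lift_linear])
      then show ?thesis by (metis X euclidean_representation part_lift(1))
    qed
  qed (auto simp: F E_plus_lift Fh)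
  then show ?thesis by (simp add: Fh endo_trace_UNIV[OF h])
qed

lemma endo_trace_gen_tangent:
  assumes F: "linear F"
  shows "endo_trace UNIV F =
    endo_trace UNIV (\<lambda>W. part_plus (F (lift g W))) + endo_trace UNIV (\<lambda>W. part_minus (F (lift g' W)))"
proof -
  note lift'_linear = gen_metric.lift_linear[OF gen_metric_neg]
  have lin: "linear (\<lambda>W. part_plus (F (lift g W)))" "linear (\<lambda>W. part_minus (F (lift g' W)))"
    using linear_compose[OF linear_compose[OF lift_linear F] part_linear(1)]
      linear_compose[OF linear_compose[OF lift'_linear F] part_linear(2)]
    by (simp_all add: o_def)
  define k where "k = case_sum (\<lambda>b u. part_plus u \<bullet> b) (\<lambda>b u. part_minus u \<bullet> b)"
  have "endo_trace UNIV F = (\<Sum>i\<in>Basis <+> Basis. k i (F (case_sum (lift g) (lift g') i)))"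
  proof (rule endo_trace_eq_sum)
    show "linear (k i)" for i
      by (cases i; rule linearI)
        (simp_all add: k_def linear_add[OF part_linear(1)] linear_scale[OF part_linear(1)]
          linear_add[OF part_linear(2)] linear_scale[OF part_linear(2)] inner_add_left)
    show "x = (\<Sum>i\<in>Basis <+> Basis. k i x *\<^sub>R case_sum (lift g) (lift g') i)" for x
    proof -
      have "lift g (\<Sum>b\<in>Basis. (X \<bullet> b) *\<^sub>R b) + lift g' (\<Sum>b\<in>Basis. (Y \<bullet> b) *\<^sub>R b) =
         (\<Sum>b\<in>Basis. (X \<bullet> b) *\<^sub>R lift g b) + (\<Sum>b\<in>Basis. (Y \<bullet> b) *\<^sub>R lift g' b)" for X Y
        by (simp only: linear_sum[OF lift_linear] linear_scale[OF lift_linear]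
            linear_sum[OF lift'_linear] linear_scale[OF lift'_linear])
      from this[of "part_plus x" "part_minus x"] lift_parts[of x]
      show ?thesis by (simp add: k_def sum.Plus euclidean_representation)
    qed
  qed (auto simp: F)
  then show ?thesis
    by (simp add: endo_trace_UNIV[OF lin(1)] endo_trace_UNIV[OF lin(2)] k_def sum.Plus)
qed

lemma dorfman_linear: "linear (\<lambda>u. dorfman br H u v)"
  by (intro linearI gen_tangent_eqI)
    (simp_all add: dorfman_snd blinfun.bilinear_simps br_simps H_simps algebra_simps, simp_all add: dorfman_def br_simps)

text \<open>Let \<open>Q\<close> be the part of \<open>D\<close> that acts purely within
  \<open>E_plus\<close>. Of the four terms of the curvature, the two in which \<open>N X\<close> is
  composed with \<open>Q\<close> have equal traces and opposite signs, so \<open>Q\<close> survives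
  only through its divergence.\<close>

lemma endo_trace_curvature:
  assumes D: "levi_civita br H g D"
  shows "endo_trace (E_plus g) (\<lambda>w. curvature br H D w (lift g' X) (lift g Y)) =
    divergence D (lift g (N X Y)) - endo_trace UNIV (\<lambda>W. N (N' W X) Y)"
proof -
  have bil: "bilinear D" using D by (auto simp: levi_civita_def gen_connection_def)
  define Q where "Q W Y = part_plus (D (lift g W) (lift g Y))" for W Y
  have Q: "D (lift g W) (lift g Y) = lift g (Q W Y)" for W Y
  proof -
    obtain Z where "D (lift g W) (lift g Y) = lift g Z"
      using D unfolding levi_civita_def E_plus_lift by blast
    then show ?thesis by (simp add: Q_def)
  qed
  have Qlin: "linear (\<lambda>W. Q W Y)" for Y
    by (rule linearI) (simp_all add: Q_def linear_add[OF lift_linear] linear_scale[OF lift_linear]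
        linear_add[OF part_linear(1)] linear_scale[OF part_linear(1)] bilinear_ladd[OF bil] bilinear_lmul[OF bil])
  have Qlin2: "linear (Q W)" for W
    by (rule linearI) (simp_all add: Q_def linear_add[OF lift_linear] linear_scale[OF lift_linear]
        linear_add[OF part_linear(1)] linear_scale[OF part_linear(1)] bilinear_radd[OF bil] bilinear_rmul[OF bil])
  have Nlin: "linear (N X)" and Nlin2: "linear (\<lambda>W. N W Y)"
    using nabla_bilinear by (auto simp: bilinear_def)
  have N'lin: "linear (\<lambda>W. N' W X)"
    using gen_metric.nabla_bilinear[OF gen_metric_neg] by (auto simp: bilinear_def)
  define h where "h W = Q W (N X Y) - N X (Q W Y) + Q (N X W) Y - N (N' W X) Y" for W
  have lins: "linear (\<lambda>W. N X (Q W Y))" "linear (\<lambda>W. Q (N X W) Y)" "linear (\<lambda>W. N (N' W X) Y)"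
    using linear_compose[OF Qlin Nlin] linear_compose[OF Nlin Qlin] linear_compose[OF N'lin Nlin2]
    by (simp_all add: o_def)
  have h_lin: "linear h" unfolding h_def
    by (intro linear_compose_sub linear_compose_add lins Qlin)
  have "linear (\<lambda>w. curvature br H D w (lift g' X) (lift g Y))"
    unfolding curvature_def
    by (rule linearI)
      (simp_all add: linear_add[OF dorfman_linear] linear_scale[OF dorfman_linear] bilinear_radd[OF bil]
        bilinear_rmul[OF bil] bilinear_ladd[OF bil] bilinear_lmul[OF bil] algebra_simps)
  moreover have "curvature br H D (lift g W) (lift g' X) (lift g Y) = lift g (h W)" for W
    by (simp add: curvature_def dorfman_lift levi_civita_mixed[OF D] Q h_def bilinear_lsub[OF bil]
        linear_add[OF lift_linear] linear_diff[OF lift_linear] algebra_simps)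
  ultimately have "endo_trace (E_plus g) (\<lambda>w. curvature br H D w (lift g' X) (lift g Y)) = endo_trace UNIV h"
    using endo_trace_E_plus h_lin by blast
  also have "\<dots> = endo_trace UNIV (\<lambda>W. Q W (N X Y)) - endo_trace UNIV (\<lambda>W. N (N' W X) Y)"
    unfolding h_def
    by (simp add: endo_trace_add endo_trace_diff lins Qlin linear_compose_sub linear_compose_add
        endo_trace_commute[OF Nlin Qlin])
  \<comment> \<open>Since \<open>D\<close> maps \<open>E_plus\<close> to itself, the diagonal block
    on \<open>E_minus\<close> vanishes, and the trace of the pure part is the full
    divergence.\<close>
  also have "endo_trace UNIV (\<lambda>W. Q W (N X Y)) = divergence D (lift g (N X Y))"
  proof -
    have "linear (\<lambda>u. D u (lift g (N X Y)))" using bil unfolding bilinear_def by blast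
    moreover have "endo_trace UNIV (\<lambda>W. 0 :: 'a) = 0"
      using endo_trace_UNIV[OF linear_zero, where 'a='a] by simp
    ultimately show ?thesis
      by (simp add: divergence_def endo_trace_gen_tangent Q levi_civita_mixed[OF D])
  qed
  finally show ?thesis .
qed

text \<open>A third of the bracket has zero torsion; adding \<open>g X Y a - g a Y X\<close>, which does not change
  the torsion, adjusts the divergence.\<close>

lemma pure_part_exists:
  fixes \<delta> :: "'a \<Rightarrow> real"
  assumes \<delta>: "linear \<delta>" and dim: "DIM('a) \<ge> 2"
  obtains Q where "bilinear Q" "\<And>X Y W. g (Q X Y) W = - g (Q X W) Y"
    "\<And>X Y W. g (Q X Y) W + g (Q Y W) X + g (Q W X) Y =
       (g (br X Y) W + g (br Y W) X + g (br W X) Y + H X Y W) / 2"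
    "\<And>Y. endo_trace UNIV (\<lambda>W. Q W Y) = \<delta> Y"
proof -
  \<comment> \<open>This 3-form is totally skew, so its cyclic sum is three times itself; hence the
    divisor 6 where the cyclic condition has 2.\<close>
  define c where "c X Y W = (g (br X Y) W + g (br Y W) X + g (br W X) Y + H X Y W) / 6" for X Y W
  have c_lin: "linear (\<lambda>X. c X Y W)" "linear (\<lambda>Y. c X Y W)" "linear (\<lambda>W. c X Y W)" for X Y W
    by (rule linearI; simp add: c_def g_simps br_simps H_simps field_simps)+
  have "\<forall>X Y. \<exists>Z. \<forall>W. g Z W = c X Y W" using riesz[OF c_lin(3)] by blast
  then obtain P where P: "\<And>X Y W. g (P X Y) W = c X Y W" by metis
  have P_lin: "linear (\<lambda>X. P X Y)" "linear (P X)" for X Y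
    by (rule linearI; rule g_eqI; simp add: g_simps P c_lin[THEN linear_add] c_lin[THEN linear_scale])+
  define t where "t Y = endo_trace UNIV (\<lambda>W. P W Y)" for Y
  \<comment> \<open>With n the dimension, the correction by \<open>a\<close> changes the trace by
    \<open>g a Y - n * g a Y\<close>; solving for \<open>a\<close> divides by n - 1, which is
    non-zero from dimension two on.\<close>
  have "linear (\<lambda>Y. (t Y - \<delta> Y) / (real DIM('a) - 1))"
    by (rule linearI)
      (simp_all add: t_def linear_add[OF P_lin(2)] linear_scale[OF P_lin(2)] linear_add[OF \<delta>]
        linear_scale[OF \<delta>] endo_trace_add endo_trace_scaleR P_lin add_divide_distrib diff_divide_distrib algebra_simps)
  from riesz[OF this] obtain a where a: "\<And>Y. g a Y = (t Y - \<delta> Y) / (real DIM('a) - 1)" by blast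
  define Q where "Q X Y = P X Y + g X Y *\<^sub>R a - g a Y *\<^sub>R X" for X Y
  show thesis
  proof
    show "bilinear Q"
      unfolding bilinear_def Q_def
      by (auto intro!: linearI simp: linear_add[OF P_lin(1)] linear_scale[OF P_lin(1)]
          linear_add[OF P_lin(2)] linear_scale[OF P_lin(2)] g_simps algebra_simps)
    show "g (Q X Y) W = - g (Q X W) Y" for X Y W
      using H_skew23[of X W Y] br_skew[of Y X] br_skew[of W Y] br_skew[of X W]
      by (simp add: Q_def g_simps P c_def g_simps field_simps)
    show "g (Q X Y) W + g (Q Y W) X + g (Q W X) Y =
       (g (br X Y) W + g (br Y W) X + g (br W X) Y + H X Y W) / 2" for X Y W
      using H_skew12[of Y X W] H_skew12[of W X Y] H_skew23[of X Y W] H_skew23[of Y W X]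
      by (simp add: Q_def g_simps P c_def g_sym[of Y X] g_sym[of W Y] g_sym[of W X] field_simps)
    show "endo_trace UNIV (\<lambda>W. Q W Y) = \<delta> Y" for Y
    proof -
      have lin2: "linear (\<lambda>W. g W Y *\<^sub>R a)" "linear (\<lambda>W::'a. g a Y *\<^sub>R W)"
        by (rule linearI; simp add: g_simps algebra_simps)+
      have "endo_trace UNIV (\<lambda>W. g W Y *\<^sub>R a) = (\<Sum>b\<in>Basis. (a \<bullet> b) * g b Y)"
        by (simp add: endo_trace_UNIV lin2 mult.commute)
      also have "\<dots> = g (\<Sum>b\<in>Basis. (a \<bullet> b) *\<^sub>R b) Y"
      proof -
        have "linear (\<lambda>x. g x Y)" using g_bilinear by (simp add: bilinear_def)
        from linear_sum[OF this, of "\<lambda>b. (a \<bullet> b) *\<^sub>R b"] show ?thesis by (simp add: g_simps)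
      qed
      finally have "endo_trace UNIV (\<lambda>W. g W Y *\<^sub>R a) = g a Y" by (simp add: euclidean_representation)
      moreover have "endo_trace UNIV (\<lambda>W::'a. g a Y *\<^sub>R W) = g a Y * DIM('a)"
        by (simp add: endo_trace_UNIV[OF lin2(2)] inner_same_Basis)
      ultimately have "endo_trace UNIV (\<lambda>W. Q W Y) = t Y + g a Y - g a Y * DIM('a)"
        by (simp add: Q_def t_def endo_trace_add endo_trace_diff linear_compose_add lin2 P_lin)
      also have "\<dots> = t Y - g a Y * (real DIM('a) - 1)" by (simp add: algebra_simps)
      also have "\<dots> = \<delta> Y" using dim by (simp add: a)
      finally show ?thesis .
    qed
  qed
qed

section \<open>Gluing the parts to a Levi-Civita generalized connection\<close>

lemma H_cyclic: "H Y Z X = H X Y Z"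
  using H_skew23[of Y Z X] H_skew12[of Y X Z] by simp

text \<open>Koszul's formula with its bracket terms in cyclic order, so that they can be matched
  with the Dorfman bracket by linear arithmetic.\<close>

lemma g_nabla_cyclic:
  "g (N X Y) Z = (g (br X Y) Z - g (br Y Z) X + g (br Z X) Y + H X Y Z) / 2"
  "g (N' X Y) Z = (g (br X Y) Z - g (br Y Z) X + g (br Z X) Y - H X Y Z) / 2"
  by (simp_all add: g_nabla g_nabla' br_skew[of X Z] g_simps g_sym[of X "br Y Z"] g_sym[of Y "br Z X"])

lemma nabla_skew: "g (N X Y) W = - g (N X W) Y"
  by (simp add: g_nabla br_skew[of W Y] H_skew23[of X W Y] g_simps
      g_sym[of W "br X Y"] g_sym[of Y "br X W"] field_simps)

lemma gen_tangent_parts: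
  "fst u = part_plus u + part_minus u"
  "blinfun_apply (snd u) Z = g (part_plus u) Z - g (part_minus u) Z"
proof -
  have "fst (lift g a + lift g' b) = a + b" "blinfun_apply (snd (lift g a + lift g' b)) Z = g a Z - g b Z" for a b
    by (simp_all add: lift_apply lift'_apply blinfun.bilinear_simps)
  then show "fst u = part_plus u + part_minus u"
    "blinfun_apply (snd u) Z = g (part_plus u) Z - g (part_minus u) Z"
    by (metis lift_parts)+
qed

lemma pairing_dorfman:
  "pairing (dorfman br H u v) w =
    (blinfun_apply (snd u) (br (fst v) (fst w)) - blinfun_apply (snd v) (br (fst u) (fst w)) +
     blinfun_apply (snd w) (br (fst u) (fst v)) + H (fst u) (fst v) (fst w)) / 2"
  by (simp add: pairing_def dorfman_snd) (simp add: dorfman_def)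

text \<open>The mixed parts have to be \<open>N\<close> and \<open>N'\<close>. The pure parts are
  free up to the cyclic condition and carry the two halves of the prescribed divergence.\<close>

lemma levi_civita_exists:
  assumes \<delta>: "linear \<delta>" and dim: "DIM('a) \<ge> 2"
  shows "\<exists>D. levi_civita br H g D \<and> divergence D = \<delta>"
proof -
  note lift'_linear = gen_metric.lift_linear[OF gen_metric_neg]
  note nabla'_bilinear = gen_metric.nabla_bilinear[OF gen_metric_neg]
  obtain Q where Q: "bilinear Q" "\<And>X Y W. g (Q X Y) W = - g (Q X W) Y"
    "\<And>X Y W. g (Q X Y) W + g (Q Y W) X + g (Q W X) Y =
       (g (br X Y) W + g (br Y W) X + g (br W X) Y + H X Y W) / 2"
    "\<And>Y. endo_trace UNIV (\<lambda>W. Q W Y) = \<delta> (lift g Y)"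
    by (rule pure_part_exists[OF linear_compose[OF lift_linear \<delta>, unfolded o_def] dim]) (rule that)
  obtain Q' where Q': "bilinear Q'" "\<And>X Y W. g (Q' X Y) W = - g (Q' X W) Y"
    "\<And>X Y W. g (Q' X Y) W + g (Q' Y W) X + g (Q' W X) Y =
       (g (br X Y) W + g (br Y W) X + g (br W X) Y - H X Y W) / 2"
    "\<And>Y. endo_trace UNIV (\<lambda>W. Q' W Y) = \<delta> (lift g' Y)"
  \<comment> \<open>The pure part on \<open>E_minus\<close> is the one on \<open>E_plus\<close> for
    \<open>neg g\<close>; dividing out the sign of the metric reverses that of
    \<open>H\<close>.\<close>
  proof -
    obtain Q' where Q': "bilinear Q'" "\<And>X Y W. g' (Q' X Y) W = - g' (Q' X W) Y"
      "\<And>X Y W. g' (Q' X Y) W + g' (Q' Y W) X + g' (Q' W X) Y =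
         (g' (br X Y) W + g' (br Y W) X + g' (br W X) Y + H X Y W) / 2"
      "\<And>Y. endo_trace UNIV (\<lambda>W. Q' W Y) = \<delta> (lift g' Y)"
      by (rule gen_metric.pure_part_exists[OF gen_metric_neg linear_compose[OF lift'_linear \<delta>, unfolded o_def] dim]) (rule that)
    have "g (Q' X Y) W + g (Q' Y W) X + g (Q' W X) Y =
       (g (br X Y) W + g (br Y W) X + g (br W X) Y - H X Y W) / 2" for X Y W
      using Q'(3)[of X Y W] by (simp add: neg_def[of g] field_simps)
    moreover have "g (Q' X Y) W = - g (Q' X W) Y" for X Y W
      using Q'(2)[of X Y W] by (simp add: neg_def[of g])
    ultimately show thesis using that Q'(1,4) by blast
  qed
  define D where "D u v = lift g (N (part_minus u) (part_plus v) + Q (part_plus u) (part_plus v)) +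
     lift g' (N' (part_plus u) (part_minus v) + Q' (part_minus u) (part_minus v))" for u v
  note bil_simps = nabla_bilinear nabla'_bilinear Q(1) Q'(1)
  have D_bil: "bilinear D"
    unfolding bilinear_def D_def
    by (intro conjI allI linearI)
      (simp_all add: part_linear[THEN linear_add] part_linear[THEN linear_scale]
        bil_simps[THEN bilinear_ladd] bil_simps[THEN bilinear_radd]
        bil_simps[THEN bilinear_lmul] bil_simps[THEN bilinear_rmul]
        lift_linear[THEN linear_add] lift_linear[THEN linear_scale]
        lift'_linear[THEN linear_add] lift'_linear[THEN linear_scale] algebra_simps)
  have D_parts: "part_plus (D u v) = N (part_minus u) (part_plus v) + Q (part_plus u) (part_plus v)"
     "part_minus (D u v) = N' (part_plus u) (part_minus v) + Q' (part_minus u) (part_minus v)" for u v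
    by (simp_all add: D_def part_linear[THEN linear_add])
  have nabla'_skew: "g (N' X Y) W = - g (N' X W) Y" for X Y W
    using gen_metric.nabla_skew[OF gen_metric_neg, of X Y W] by (simp add: neg_def[of g])
  have conn: "gen_connection D"
  proof -
    have "pairing (D u v) w + pairing v (D u w) = 0" for u v w
      using nabla_skew[of "part_minus u" "part_plus v" "part_plus w"]
        nabla'_skew[of "part_plus u" "part_minus v" "part_minus w"]
        Q(2)[of "part_plus u" "part_plus v" "part_plus w"]
        Q'(2)[of "part_minus u" "part_minus v" "part_minus w"]
      by (simp add: pairing_parts D_parts g_simps g_sym[of "part_plus v"] g_sym[of "part_minus v"])
    then show ?thesis using D_bil by (simp add: gen_connection_def)
  qed
  have "torsion br H D u v = 0" for u v
  proof -
    \<comment> \<open>Moving the adjoint across the pairing and using that each \<open>D v\<close>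
      is skew turns the torsion into the cyclic sum of \<open>pairing (D u v) w\<close> minus the
      bracket term.\<close>
    have "pairing (torsion br H D u v) w = 0" for w
    proof -
      have "linear (\<lambda>w. D w u)" using D_bil unfolding bilinear_def by blast
      from pairing_adjoint[OF this, of w v]
      have "pairing (torsion br H D u v) w =
          pairing (D u v) w - pairing (D v u) w - pairing (dorfman br H u v) w + pairing (D w u) v"
        by (simp add: torsion_def pairing_simps pairing_sym[of _ w])
      also have "pairing (D v u) w = - pairing (D v w) u"
        using conn pairing_sym[of u "D v w"] unfolding gen_connection_def eq_neg_iff_add_eq_0 by metis
      also have "pairing (D u v) w - - pairing (D v w) u - pairing (dorfman br H u v) w + pairing (D w u) v = 0"
      proof -
        define a b c where "a = part_plus u" and "b = part_plus v" and "c = part_plus w"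
        define a' b' c' where "a' = part_minus u" and "b' = part_minus v" and "c' = part_minus w"
        note ab = a_def[symmetric] b_def[symmetric] c_def[symmetric] a'_def[symmetric] b'_def[symmetric] c'_def[symmetric]
        have dorf: "pairing (dorfman br H u v) w =
          (g (br (a + a') (b + b')) (c - c') + g (br (b + b') (c + c')) (a - a') +
           g (br (c + c') (a + a')) (b - b') + H (a + a') (b + b') (c + c')) / 2"
          unfolding pairing_dorfman gen_tangent_parts ab
          by (simp add: g_simps br_simps br_skew[of a c] br_skew[of a' c] br_skew[of a c'] br_skew[of a' c']
              g_sym[of _ "br _ _"] algebra_simps)
        \<comment> \<open>Expanding into eigenbundle components, the pure terms cancel by the cyclic
          conditions on \<open>Q\<close> and \<open>Q'\<close>, the mixed ones by Koszul's formula,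
          once the values of \<open>H\<close> are rotated to a common order.\<close>
        show ?thesis
          unfolding dorf
          unfolding pairing_parts D_parts ab g_simps br_simps H_simps g_nabla_cyclic
          using Q(3)[of a b c] Q'(3)[of a' b' c'] H_cyclic[of a b' c] H_cyclic[of a' b c]
            H_cyclic[of a' b c'] H_cyclic[of a b' c'] H_cyclic[of a b c'] H_cyclic[of a' b' c]
            H_cyclic[of b c a'] H_cyclic[of b' c a] H_cyclic[of b c' a'] H_cyclic[of b' c' a]
            H_cyclic[of b c' a] H_cyclic[of b' c a']
          by argo
      qed
      finally show ?thesis .
    qed
    then show ?thesis by (intro pairing_eqI) (simp_all add: pairing_simps)
  qed
  moreover have "D u ` E_plus g \<subseteq> E_plus g \<and> D u ` E_minus g \<subseteq> E_minus g" for u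
    by (auto simp: E_plus_lift E_minus_lift D_def bil_simps[THEN bilinear_rzero]
        linear_0[OF lift_linear] linear_0[OF lift'_linear])
  ultimately have "levi_civita br H g D" using conn by (simp add: levi_civita_def)
  moreover have "divergence D = \<delta>"
  proof
    fix v
    have "linear (\<lambda>u. D u v)" using D_bil unfolding bilinear_def by blast
    then have "divergence D v = \<delta> (lift g (part_plus v)) + \<delta> (lift g' (part_minus v))"
      by (simp add: divergence_def endo_trace_gen_tangent D_parts bil_simps[THEN bilinear_lzero] Q(4) Q'(4))
    also have "\<dots> = \<delta> v" using lift_parts[of v] linear_add[OF \<delta>] by metis
    finally show "divergence D v = \<delta> v" .
  qed
  ultimately show ?thesis by blast
qed

section \<open>The Einstein equations in terms of the two metric connections\<close>

lemma ricci_plus_eq: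
  assumes "linear \<delta>" and "DIM('a) \<ge> 2"
  shows "ricci_plus br H g \<delta> (lift g' X) (lift g Y) =
    \<delta> (lift g (N X Y)) - endo_trace UNIV (\<lambda>W. N (N' W X) Y)"
proof -
  \<comment> \<open>The chosen connection is a genuine one, and the trace formula sees it only
    through its divergence; so the choice does not matter.\<close>
  have "levi_civita br H g (lc_connection br H g \<delta>) \<and> divergence (lc_connection br H g \<delta>) = \<delta>"
    unfolding lc_connection_def using someI_ex[OF levi_civita_exists[OF assms]] .
  then show ?thesis unfolding ricci_plus_def using endo_trace_curvature by metis
qed

lemma ricci_minus_eq:
  assumes "linear \<delta>" and "DIM('a) \<ge> 2"
  shows "ricci_minus br H g \<delta> (lift g Y) (lift g' X) =
    \<delta> (lift g' (N' Y X)) - endo_trace UNIV (\<lambda>W. N' (N W Y) X)"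
proof -
  \<comment> \<open>The conditions defining the choice are the same for \<open>g\<close> and
    \<open>neg g\<close>, so the very same connection is chosen.\<close>
  have "lc_connection br H g' \<delta> = lc_connection br H g \<delta>"
    unfolding lc_connection_def levi_civita_neg ..
  then have "ricci_minus br H g \<delta> (lift g Y) (lift g' X) = ricci_plus br H g' \<delta> (lift g Y) (lift g' X)"
    by (simp add: ricci_minus_def ricci_plus_def E_plus_neg)
  then show ?thesis
    using gen_metric.ricci_plus_eq[OF gen_metric_neg assms, of Y X] by simp
qed

lemma gen_einstein_iff:
  assumes "linear \<delta>" and "DIM('a) \<ge> 2"
  shows "gen_einstein br H g \<delta> \<longleftrightarrow>
    (\<forall>X Y. \<delta> (lift g (N X Y)) = endo_trace UNIV (\<lambda>W. N (N' W X) Y)) \<and>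
    (\<forall>X Y. \<delta> (lift g' (N' X Y)) = endo_trace UNIV (\<lambda>W. N' (N W X) Y))"
  using H_alt g_metric assms
  by (auto simp: gen_einstein_def E_plus_lift E_minus_lift ricci_plus_eq ricci_minus_eq)

end

section \<open>Einstein equations on almost abelian Lie algebras\<close>

locale basis3 =
  fixes e0 e1 e2 :: "'a::euclidean_space" and k0 k1 k2 :: "'a \<Rightarrow> real"
  assumes k_linear: "linear k0" "linear k1" "linear k2"
    and expand: "x = k0 x *\<^sub>R e0 + k1 x *\<^sub>R e1 + k2 x *\<^sub>R e2"
    and k_basis [simp]: "k0 e0 = 1" "k1 e0 = 0" "k2 e0 = 0" "k0 e1 = 0" "k1 e1 = 1" "k2 e1 = 0"
      "k0 e2 = 0" "k1 e2 = 0" "k2 e2 = 1"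
begin

lemmas k_simps = k_linear[THEN linear_add] k_linear[THEN linear_diff] k_linear[THEN linear_scale]
  k_linear[THEN linear_neg] k_linear[THEN linear_0]

lemma k_eqI: "k0 x = k0 y \<Longrightarrow> k1 x = k1 y \<Longrightarrow> k2 x = k2 y \<Longrightarrow> x = y"
  by (subst expand[of x], subst expand[of y]) simp

lemma linear_expand:
  assumes "linear f"
  shows "f x = k0 x *\<^sub>R f e0 + k1 x *\<^sub>R f e1 + k2 x *\<^sub>R f e2"
proof -
  have "f (k0 x *\<^sub>R e0 + k1 x *\<^sub>R e1 + k2 x *\<^sub>R e2) = k0 x *\<^sub>R f e0 + k1 x *\<^sub>R f e1 + k2 x *\<^sub>R f e2"
    by (simp add: linear_add[OF assms] linear_scale[OF assms])
  then show ?thesis unfolding expand[symmetric] .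
qed

lemma endo_trace_basis3:
  assumes "linear f"
  shows "endo_trace UNIV f = k0 (f e0) + k1 (f e1) + k2 (f e2)"
proof -
  define c k where "c = ((\<lambda>_. e2)(0 := e0, 1 := e1) :: nat \<Rightarrow> 'a)" and "k = ((\<lambda>_. k2)(0 := k0, 1 := k1) :: nat \<Rightarrow> _)"
  have "endo_trace UNIV f = (\<Sum>i\<in>{0, 1, 2::nat}. k i (f (c i)))"
  proof (rule endo_trace_eq_sum[where k = k and c = c])
    show "x = (\<Sum>i\<in>{0, 1, 2::nat}. k i x *\<^sub>R c i)" for x
      by (simp add: c_def k_def add.assoc[symmetric] flip: expand)
  qed (auto simp: k_def k_linear assms)
  then show ?thesis by (simp add: c_def k_def)
qed

end

lemma basis3_exists:
  fixes e0 e1 e2 :: "'a::euclidean_space"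
  assumes dim: "DIM('a) = 3"
    and indep: "\<And>a b c. a *\<^sub>R e0 + b *\<^sub>R e1 + c *\<^sub>R e2 = 0 \<Longrightarrow> a = 0 \<and> b = 0 \<and> c = 0"
  obtains k0 k1 k2 where "basis3 e0 e1 e2 k0 k1 k2"
proof -
  define \<psi> where "\<psi> = (\<lambda>(a, b, c). a *\<^sub>R e0 + b *\<^sub>R e1 + c *\<^sub>R e2 :: 'a)"
  have lin: "linear \<psi>"
    by (rule linearI) (auto simp: \<psi>_def algebra_simps)
  have inj: "inj \<psi>"
    unfolding linear_injective_0[OF lin] using indep by (auto simp: \<psi>_def zero_prod_def)
  have "dim (range \<psi>) = DIM(real \<times> real \<times> real)"
    using dim_image_eq[OF lin, of UNIV] inj by simp
  then have "dim (range \<psi>) = DIM('a)" by (simp add: dim)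
  then have surj: "surj \<psi>"
    using dim_eq_full[of "range \<psi>"] linear_subspace_image[OF lin subspace_UNIV] by (metis span_eq_iff)
  define \<phi> where "\<phi> = inv \<psi>"
  have \<phi>\<psi>: "\<phi> (\<psi> x) = x" and \<psi>\<phi>: "\<psi> (\<phi> y) = y" for x y
    unfolding \<phi>_def using inj surj by (simp_all add: surj_f_inv_f)
  have \<phi>_lin: "linear \<phi>"
    by (rule linearI; rule injD[OF inj]; simp add: \<psi>\<phi> linear_add[OF lin] linear_scale[OF lin])
  have e: "\<phi> e0 = (1, 0, 0)" "\<phi> e1 = (0, 1, 0)" "\<phi> e2 = (0, 0, 1)"
    using \<phi>\<psi>[of "(1, 0, 0)"] \<phi>\<psi>[of "(0, 1, 0)"] \<phi>\<psi>[of "(0, 0, 1)"] by (simp_all add: \<psi>_def)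
  have "basis3 e0 e1 e2 (\<lambda>x. fst (\<phi> x)) (\<lambda>x. fst (snd (\<phi> x))) (\<lambda>x. snd (snd (\<phi> x)))"
  proof
    show "x = fst (\<phi> x) *\<^sub>R e0 + fst (snd (\<phi> x)) *\<^sub>R e1 + snd (snd (\<phi> x)) *\<^sub>R e2" for x
      using \<psi>\<phi>[of x] by (simp add: \<psi>_def split_beta)
  qed (auto simp: e intro!: linearI simp: linear_add[OF \<phi>_lin] linear_scale[OF \<phi>_lin])
  then show thesis by (rule that)
qed

text \<open>The abelian ideal is spanned by \<open>e1\<close> and \<open>e2\<close>;
  \<open>a\<close>, \<open>b\<close>, \<open>c\<close>, \<open>d\<close> are, row by row, the
  entries of the matrix of the adjoint action of \<open>e0\<close> on it.\<close>

locale almost_abelian = basis3 e0 e1 e2 k0 k1 k2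
  for e0 e1 e2 :: "'a::euclidean_space" and k0 k1 k2 :: "'a \<Rightarrow> real" +
  fixes br :: "'a \<Rightarrow> 'a \<Rightarrow> 'a" and a b c d :: real
  assumes br_eq: "br x y = (k0 x * k1 y - k1 x * k0 y) *\<^sub>R (a *\<^sub>R e1 + c *\<^sub>R e2) +
    (k0 x * k2 y - k2 x * k0 y) *\<^sub>R (b *\<^sub>R e1 + d *\<^sub>R e2)"
begin

lemma k_br [simp]: "k0 (br x y) = 0"
  "k1 (br x y) = (k0 x * k1 y - k1 x * k0 y) * a + (k0 x * k2 y - k2 x * k0 y) * b"
  "k2 (br x y) = (k0 x * k1 y - k1 x * k0 y) * c + (k0 x * k2 y - k2 x * k0 y) * d"
  by (simp_all add: br_eq k_simps)

lemma lie_isomorphic_semidirect: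
  "lie_isomorphic br (semidirect_bracket (vector [vector [a, b], vector [c, d]]))"
proof -
  define \<phi> where "\<phi> x = (k0 x, vector [k1 x, k2 x] :: real^2)" for x
  have "linear \<phi>"
    by (rule linearI) (auto simp: \<phi>_def k_simps vec_eq_iff forall_2)
  moreover have "bij \<phi>"
  proof (rule bijI)
    show "inj \<phi>"
      by (rule injI) (auto simp: \<phi>_def vec_eq_iff forall_2 intro: k_eqI)
    show "surj \<phi>"
    proof (rule surjI)
      show "\<phi> (fst y *\<^sub>R e0 + (snd y $ 1) *\<^sub>R e1 + (snd y $ 2) *\<^sub>R e2) = y" for y
        by (cases y) (auto simp: \<phi>_def k_simps vec_eq_iff forall_2)
    qed
  qed
  moreover have "\<phi> (br x y) = semidirect_bracket (vector [vector [a, b], vector [c, d]]) (\<phi> x) (\<phi> y)" for x y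
    by (auto simp: \<phi>_def semidirect_bracket_def vec_eq_iff forall_2 matrix_vector_mult_def sum_2 algebra_simps)
  ultimately show ?thesis unfolding lie_isomorphic_def by blast
qed

lemma br_bilinear_alt: "bilinear br" "br x x = 0"
  by (auto simp: bilinear_def intro!: linearI k_eqI simp: k_simps algebra_simps)

lemma unimodular_kernel_eq: "unimodular_kernel br = {x. k0 x * (a + d) = 0}"
proof -
  have "linear (br x)" for x using br_bilinear_alt(1) by (simp add: bilinear_def)
  then show ?thesis by (simp add: unimodular_kernel_def endo_trace_basis3 algebra_simps)
qed

end

text \<open>A 3-form has a single component in this frame. With \<open>f\<close> half of it,
  replacing \<open>f\<close> by \<open>-f\<close> exchanges the coordinates of \<open>N\<close> and
  \<open>N'\<close>.\<close>

locale almost_abelian_metric = almost_abelian e0 e1 e2 k0 k1 k2 br a b c d + gen_metric br H g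
  for e0 e1 e2 :: "'a::euclidean_space" and k0 k1 k2 br a b c d H g +
  fixes f :: real
  assumes f: "f = H e0 e1 e2 / 2"
begin

lemma H_eq: "H x y z = 2 * f *
  (k0 x * (k1 y * k2 z - k2 y * k1 z) - k1 x * (k0 y * k2 z - k2 y * k0 z) + k2 x * (k0 y * k1 z - k1 y * k0 z))"
proof -
  have "H (x0 *\<^sub>R e0 + x1 *\<^sub>R e1 + x2 *\<^sub>R e2) (y0 *\<^sub>R e0 + y1 *\<^sub>R e1 + y2 *\<^sub>R e2)
      (z0 *\<^sub>R e0 + z1 *\<^sub>R e1 + z2 *\<^sub>R e2) =
    2 * f * (x0 * (y1 * z2 - y2 * z1) - x1 * (y0 * z2 - y2 * z0) + x2 * (y0 * z1 - y1 * z0))"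
    for x0 x1 x2 y0 y1 y2 z0 z1 z2
    by (simp add: H_simps f H_skew12[of e1 e0] H_skew12[of e2 e0] H_skew12[of e2 e1] H_skew23[of e0 e2 e1]
      H_skew23[of e1 e2 e0] algebra_simps)
  from this[of "k0 x" "k1 x" "k2 x" "k0 y" "k1 y" "k2 y" "k0 z" "k1 z" "k2 z"]
  show ?thesis unfolding expand[symmetric] .
qed

lemma H_zero: "f = 0 \<Longrightarrow> H = (\<lambda>_ _ _. 0)"
  by (simp add: H_eq fun_eq_iff)

end

locale almost_abelian_einstein = almost_abelian_metric e0 e1 e2 k0 k1 k2 br a b c d H g f
  for e0 e1 e2 :: "'a::euclidean_space" and k0 k1 k2 br a b c d H g f +
  fixes \<delta> :: "'a gen_tangent \<Rightarrow> real"
  assumes einstein: "gen_einstein br H g \<delta>" and \<delta>_nonzero: "\<delta> \<noteq> (\<lambda>_. 0)"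
    and dim: "DIM('a) = 3" and trace: "a + d \<noteq> 0"
begin

lemma \<delta>_linear: "linear \<delta>"
  using einstein by (simp add: gen_einstein_def)

lemma \<delta>_lift:
  "\<delta> (lift g x) = k0 x * \<delta> (lift g e0) + k1 x * \<delta> (lift g e1) + k2 x * \<delta> (lift g e2)"
  "\<delta> (lift g' x) = k0 x * \<delta> (lift g' e0) + k1 x * \<delta> (lift g' e1) + k2 x * \<delta> (lift g' e2)"
  using linear_expand[OF linear_compose[OF lift_linear \<delta>_linear], of x]
    linear_expand[OF linear_compose[OF gen_metric.lift_linear[OF gen_metric_neg] \<delta>_linear], of x]
  by (simp_all add: o_def)

lemmas \<delta>_nabla = \<delta>_lift(1)[of "N x y" for x y] \<delta>_lift(2)[of "N' x y" for x y]

lemma \<delta>_zeroI: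
  assumes "\<And>i. i \<in> {e0, e1, e2} \<Longrightarrow> \<delta> (lift g i) = 0" "\<And>i. i \<in> {e0, e1, e2} \<Longrightarrow> \<delta> (lift g' i) = 0"
  shows False
proof -
  have "\<delta> (lift g x + lift g' y) = 0" for x y
    using \<delta>_lift(1)[of x] \<delta>_lift(2)[of y] assms by (simp add: linear_add[OF \<delta>_linear])
  then have "\<delta> u = 0" for u
    by (metis lift_parts)
  then show False using \<delta>_nonzero by blast
qed

lemma einstein_eqs:
  "\<delta> (lift g (N x y)) = k0 (N (N' e0 x) y) + k1 (N (N' e1 x) y) + k2 (N (N' e2 x) y)"
  "\<delta> (lift g' (N' x y)) = k0 (N' (N e0 x) y) + k1 (N' (N e1 x) y) + k2 (N' (N e2 x) y)"
proof -
  have lin: "linear (\<lambda>w. N w z)" "linear (\<lambda>w. N' w z)" for z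
    using nabla_bilinear gen_metric.nabla_bilinear[OF gen_metric_neg] unfolding bilinear_def by blast+
  note lin = linear_compose[OF lin(2)[of x] lin(1)[of y], unfolded o_def]
    linear_compose[OF lin(1)[of x] lin(2)[of y], unfolded o_def]
  have "\<delta> (lift g (N x y)) = endo_trace UNIV (\<lambda>w. N (N' w x) y)"
    "\<delta> (lift g' (N' x y)) = endo_trace UNIV (\<lambda>w. N' (N w x) y)"
    using iffD1[OF gen_einstein_iff[OF \<delta>_linear] einstein] dim by auto
  then show "\<delta> (lift g (N x y)) = k0 (N (N' e0 x) y) + k1 (N (N' e1 x) y) + k2 (N (N' e2 x) y)"
    "\<delta> (lift g' (N' x y)) = k0 (N' (N e0 x) y) + k1 (N' (N e1 x) y) + k2 (N' (N e2 x) y)"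
    unfolding endo_trace_basis3[OF lin(1)] endo_trace_basis3[OF lin(2)] .
qed

end

section \<open>Orthogonal frames: the unimodular kernel is non-degenerate\<close>

locale orthogonal_case = almost_abelian_einstein e0 e1 e2 k0 k1 k2 br a b c d H g f \<delta>
  for e0 e1 e2 :: "'a::euclidean_space" and k0 k1 k2 br a b c d H g f \<delta> +
  fixes q0 q1 q2 :: real
  assumes g_eq: "g x y = q0 * k0 x * k0 y + q1 * k1 x * k1 y + q2 * k2 x * k2 y"
    and q_nonzero: "q0 \<noteq> 0" "q1 \<noteq> 0" "q2 \<noteq> 0"
begin

text \<open>The off-diagonal entries, with respect to \<open>g\<close>, of the skew and symmetric parts of the
  matrix of the adjoint action of \<open>e0\<close>.\<close>

definition "\<kappa> = (c * q2 - b * q1) / 2"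
definition "\<sigma> = (c * q2 + b * q1) / 2"

lemma nabla_coords:
  "k0 (N x y) = (a * q1 * k1 x * k1 y + (\<sigma> + f) * k1 x * k2 y + (\<sigma> - f) * k2 x * k1 y + d * q2 * k2 x * k2 y) / q0"
  "k1 (N x y) = (- ((\<kappa> + f) * k0 x * k2 y + a * q1 * k1 x * k0 y + (\<sigma> - f) * k2 x * k0 y)) / q1"
  "k2 (N x y) = ((\<kappa> + f) * k0 x * k1 y - (\<sigma> + f) * k1 x * k0 y - d * q2 * k2 x * k0 y) / q2"
proof -
  \<comment> \<open>In an orthogonal frame, pairing Koszul's formula with a frame vector isolates
    one coordinate.\<close>
  have "k0 (N x y) * q0 = a * q1 * k1 x * k1 y + (\<sigma> + f) * k1 x * k2 y + (\<sigma> - f) * k2 x * k1 y + d * q2 * k2 x * k2 y"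
    "k1 (N x y) * q1 = - ((\<kappa> + f) * k0 x * k2 y + a * q1 * k1 x * k0 y + (\<sigma> - f) * k2 x * k0 y)"
    "k2 (N x y) * q2 = (\<kappa> + f) * k0 x * k1 y - (\<sigma> + f) * k1 x * k0 y - d * q2 * k2 x * k0 y"
    using g_nabla[of x y e0] g_nabla[of x y e1] g_nabla[of x y e2]
    by (simp_all add: g_eq H_eq \<kappa>_def \<sigma>_def field_simps)
  then show "k0 (N x y) = (a * q1 * k1 x * k1 y + (\<sigma> + f) * k1 x * k2 y + (\<sigma> - f) * k2 x * k1 y + d * q2 * k2 x * k2 y) / q0"
    "k1 (N x y) = (- ((\<kappa> + f) * k0 x * k2 y + a * q1 * k1 x * k0 y + (\<sigma> - f) * k2 x * k0 y)) / q1"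
    "k2 (N x y) = ((\<kappa> + f) * k0 x * k1 y - (\<sigma> + f) * k1 x * k0 y - d * q2 * k2 x * k0 y) / q2"
    using q_nonzero by (simp_all add: nonzero_eq_divide_eq)
qed

lemma nabla'_coords:
  "k0 (N' x y) = (a * q1 * k1 x * k1 y + (\<sigma> - f) * k1 x * k2 y + (\<sigma> + f) * k2 x * k1 y + d * q2 * k2 x * k2 y) / q0"
  "k1 (N' x y) = (- ((\<kappa> - f) * k0 x * k2 y + a * q1 * k1 x * k0 y + (\<sigma> + f) * k2 x * k0 y)) / q1"
  "k2 (N' x y) = ((\<kappa> - f) * k0 x * k1 y - (\<sigma> - f) * k1 x * k0 y - d * q2 * k2 x * k0 y) / q2"
proof -
  have "k0 (N' x y) * q0 = a * q1 * k1 x * k1 y + (\<sigma> - f) * k1 x * k2 y + (\<sigma> + f) * k2 x * k1 y + d * q2 * k2 x * k2 y"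
    "k1 (N' x y) * q1 = - ((\<kappa> - f) * k0 x * k2 y + a * q1 * k1 x * k0 y + (\<sigma> + f) * k2 x * k0 y)"
    "k2 (N' x y) * q2 = (\<kappa> - f) * k0 x * k1 y - (\<sigma> - f) * k1 x * k0 y - d * q2 * k2 x * k0 y"
    using g_nabla'[of x y e0] g_nabla'[of x y e1] g_nabla'[of x y e2]
    by (simp_all add: g_eq H_eq \<kappa>_def \<sigma>_def field_simps)
  then show "k0 (N' x y) = (a * q1 * k1 x * k1 y + (\<sigma> - f) * k1 x * k2 y + (\<sigma> + f) * k2 x * k1 y + d * q2 * k2 x * k2 y) / q0"
    "k1 (N' x y) = (- ((\<kappa> - f) * k0 x * k2 y + a * q1 * k1 x * k0 y + (\<sigma> + f) * k2 x * k0 y)) / q1"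
    "k2 (N' x y) = ((\<kappa> - f) * k0 x * k1 y - (\<sigma> - f) * k1 x * k0 y - d * q2 * k2 x * k0 y) / q2"
    using q_nonzero by (simp_all add: nonzero_eq_divide_eq)
qed

text \<open>The Gram determinant of \<open>g\<close> on the span of \<open>e1\<close> and
  \<open>e2\<close>; its sign decides between definite and Lorentzian.\<close>

definition "m = q1 * q2"
abbreviation "dp \<equiv> \<delta> (lift g e0)"
abbreviation "dm \<equiv> \<delta> (lift g' e0)"

lemma m_nonzero: "m \<noteq> 0"
  using q_nonzero by (simp add: m_def)

text \<open>Since \<open>N e0 e0 = 0\<close>, the divergence does not enter this component.\<close>

lemma einstein_e0_e0: "m * (a\<^sup>2 + d\<^sup>2) + 2 * (\<sigma>\<^sup>2 + f\<^sup>2) = 0"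
proof -
  have "m * (m * (a\<^sup>2 + d\<^sup>2) + 2 * (\<sigma>\<^sup>2 + f\<^sup>2)) = 0"
    using einstein_eqs(1)[of e0 e0] q_nonzero
    by (simp add: \<delta>_nabla nabla_coords nabla'_coords m_def field_simps power2_eq_square)
  then show ?thesis using m_nonzero by simp
qed

text \<open>The connection sends pairs from \<open>e1\<close>, \<open>e2\<close> to multiples of
  \<open>e0\<close>, so only \<open>dp\<close> enters. The last two equations are half the sum and
  half the difference of the off-diagonal components.\<close>

lemma einstein_plus:
  "m * dp * a = 2 * (\<kappa> * \<sigma> + f\<^sup>2)" "m * dp * d = 2 * (f\<^sup>2 - \<kappa> * \<sigma>)"
  "dp * \<sigma> = (d - a) * \<kappa>" "dp * f = - (a + d) * f"
proof -
  have "q0 * q2 * (m * dp * a) = q0 * q2 * (2 * (\<kappa> * \<sigma> + f\<^sup>2))"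
    using einstein_eqs(1)[of e1 e1] q_nonzero
    by (simp add: \<delta>_nabla nabla_coords nabla'_coords m_def field_simps power2_eq_square)
  then show "m * dp * a = 2 * (\<kappa> * \<sigma> + f\<^sup>2)" using q_nonzero by simp
  have "q0 * q1 * (m * dp * d) = q0 * q1 * (2 * (f\<^sup>2 - \<kappa> * \<sigma>))"
    using einstein_eqs(1)[of e2 e2] q_nonzero
    by (simp add: \<delta>_nabla nabla_coords nabla'_coords m_def field_simps power2_eq_square)
  then show "m * dp * d = 2 * (f\<^sup>2 - \<kappa> * \<sigma>)" using q_nonzero by simp
  have "dp * (\<sigma> + f) = (\<kappa> - f) * d - a * (\<kappa> + f)"
  proof -
    have "q0 * q0 * q1 * q2 * (dp * (\<sigma> + f)) = q0 * q0 * q1 * q2 * ((\<kappa> - f) * d - a * (\<kappa> + f))"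
      using einstein_eqs(1)[of e1 e2] q_nonzero
      by (simp add: \<delta>_nabla nabla_coords nabla'_coords field_simps)
    then show ?thesis using q_nonzero by simp
  qed
  moreover have "dp * (\<sigma> - f) = d * (\<kappa> + f) - a * (\<kappa> - f)"
  proof -
    have "q0 * q0 * q1 * q2 * (dp * (\<sigma> - f)) = q0 * q0 * q1 * q2 * (d * (\<kappa> + f) - a * (\<kappa> - f))"
      using einstein_eqs(1)[of e2 e1] q_nonzero
      by (simp add: \<delta>_nabla nabla_coords nabla'_coords field_simps)
    then show ?thesis using q_nonzero by simp
  qed
  ultimately show "dp * \<sigma> = (d - a) * \<kappa>" "dp * f = - (a + d) * f"
    by (simp_all add: algebra_simps)
qed

lemma einstein_minus: "m * dm * a = 2 * (\<kappa> * \<sigma> + f\<^sup>2)" "m * dm * d = 2 * (f\<^sup>2 - \<kappa> * \<sigma>)"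
proof -
  have "q0 * q2 * (m * dm * a) = q0 * q2 * (2 * (\<kappa> * \<sigma> + f\<^sup>2))"
    using einstein_eqs(2)[of e1 e1] q_nonzero
    by (simp add: \<delta>_nabla nabla_coords nabla'_coords m_def field_simps power2_eq_square)
  then show "m * dm * a = 2 * (\<kappa> * \<sigma> + f\<^sup>2)" using q_nonzero by simp
  have "q0 * q1 * (m * dm * d) = q0 * q1 * (2 * (f\<^sup>2 - \<kappa> * \<sigma>))"
    using einstein_eqs(2)[of e2 e2] q_nonzero
    by (simp add: \<delta>_nabla nabla_coords nabla'_coords m_def field_simps power2_eq_square)
  then show "m * dm * d = 2 * (f\<^sup>2 - \<kappa> * \<sigma>)" using q_nonzero by simp
qed

text \<open>If \<open>f = 0\<close>, adding the diagonal equations gives \<open>dp = dm = 0\<close>.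
  The values of the divergence over \<open>e1\<close> and \<open>e2\<close> then solve homogeneous
  linear systems with non-zero determinant, so the divergence vanishes altogether.\<close>

lemma f_nonzero: "f \<noteq> 0"
proof
  assume [simp]: "f = 0"
  have "m * dp * (a + d) = 0" "m * dm * (a + d) = 0"
    using einstein_plus(1,2) einstein_minus by (simp_all add: distrib_left)
  then have [simp]: "dp = 0" "dm = 0" using m_nonzero trace by auto
  \<comment> \<open>The determinant of the coming linear systems is controlled by the
    \<open>e0\<close>, \<open>e0\<close> equation and the non-zero trace.\<close>
  have det: "2 * (m * (a * d) - \<sigma>\<^sup>2) = m * (a + d)\<^sup>2"
    using einstein_e0_e0 by (simp add: power2_eq_square algebra_simps)
  then have det0: "m * (a * d) - \<sigma>\<^sup>2 \<noteq> 0"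
    using m_nonzero trace by auto
  have lin: "x = 0 \<and> y = 0" if "a * q2 * x + \<sigma> * y = 0" "\<sigma> * x + d * q1 * y = 0" for x y
  proof -
    have "x * (m * (a * d) - \<sigma>\<^sup>2) = 0" "y * (m * (a * d) - \<sigma>\<^sup>2) = 0"
      using that by (simp_all add: m_def power2_eq_square) algebra+
    then show ?thesis using det0 by simp
  qed
  have *: "\<delta> (lift g e1) = 0 \<and> \<delta> (lift g e2) = 0"
    using einstein_eqs(1)[of e1 e0] einstein_eqs(1)[of e2 e0] q_nonzero
    by (intro lin) (simp_all add: \<delta>_nabla nabla_coords nabla'_coords field_simps)
  have **: "\<delta> (lift g' e1) = 0 \<and> \<delta> (lift g' e2) = 0"
    using einstein_eqs(2)[of e1 e0] einstein_eqs(2)[of e2 e0] q_nonzero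
    by (intro lin) (simp_all add: \<delta>_nabla nabla_coords nabla'_coords field_simps)
  show False using * ** by (intro \<delta>_zeroI) auto
qed

text \<open>The Einstein equations give \<open>m < 0\<close> and make \<open>m\<close> times the
  discriminant of the characteristic polynomial equal to \<open>- 4 * \<kappa>\<^sup>2\<close>. So
  the discriminant is positive unless \<open>\<kappa> = 0\<close>; then \<open>\<sigma> = 0\<close>
  as well and the matrix is scalar.\<close>

lemma diagonalizable: "(a - d)\<^sup>2 + 4 * b * c > 0 \<or> a = d \<and> b = 0 \<and> c = 0"
proof -
  have dp: "dp = - (a + d)" using einstein_plus(4) f_nonzero by (simp only: mult_cancel_right simp_thms)
  have "m * (a + d)\<^sup>2 = - 4 * f\<^sup>2"
    using einstein_plus(1,2) by (simp add: dp power2_eq_square algebra_simps)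
  then have E1: "m * (a - d)\<^sup>2 = - 4 * \<sigma>\<^sup>2"
    using einstein_e0_e0 by (simp add: power2_eq_square algebra_simps)
  have "m * (a\<^sup>2 + d\<^sup>2) < 0"
    using einstein_e0_e0 f_nonzero by (smt (verit) zero_less_power2 zero_le_power2)
  then have m: "m < 0" by (smt (verit) mult_nonneg_nonneg zero_le_power2)
  have "m * (4 * b * c) = 4 * (\<sigma>\<^sup>2 - \<kappa>\<^sup>2)"
    by (simp add: m_def \<sigma>_def \<kappa>_def power2_eq_square field_simps)
  then have disc: "m * ((a - d)\<^sup>2 + 4 * b * c) = - 4 * \<kappa>\<^sup>2"
    using E1 by (simp add: algebra_simps)
  show ?thesis
  proof (cases "\<kappa> = 0")
    case True
    then have "\<sigma> = 0" using einstein_plus(3) dp trace by simp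
    then show ?thesis
      using True E1 m q_nonzero by (auto simp: \<sigma>_def \<kappa>_def)
  next
    case False
    then have "m * ((a - d)\<^sup>2 + 4 * b * c) < 0" using disc by simp
    then show ?thesis using m by (simp add: mult_less_0_iff)
  qed
qed

end

section \<open>Null frames: the unimodular kernel is degenerate\<close>

locale null_frame = almost_abelian_metric e0 e1 e2 k0 k1 k2 br a b c d H g f
  for e0 e1 e2 :: "'a::euclidean_space" and k0 k1 k2 br a b c d H g f +
  fixes s :: real
  assumes g_eq: "g x y = k0 x * k1 y + k1 x * k0 y + s * k2 x * k2 y"
    and s_nonzero: "s \<noteq> 0"
begin

text \<open>\<open>p\<close> and \<open>q\<close> are half of \<open>g (br e0 e1) e2\<close> plus
  and minus \<open>H e0 e1 e2\<close>. Exchanging the two connections swaps them, and both vanish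
  exactly if \<open>c = 0\<close> and \<open>f = 0\<close>.\<close>

definition "p = c * s / 2 + f"
definition "q = c * s / 2 - f"

lemma nabla_coords:
  "k0 (N x y) = - a * k0 x * k0 y - p * k0 x * k2 y - q * k2 x * k0 y"
  "k1 (N x y) = a * k0 x * k1 y + b * k0 x * k2 y + p * k1 x * k2 y + q * k2 x * k1 y + d * s * k2 x * k2 y"
  "k2 (N x y) = (- b * k0 x * k0 y + p * k0 x * k1 y - p * k1 x * k0 y) / s - d * k2 x * k0 y"
  using g_nabla[of x y e0] g_nabla[of x y e1] g_nabla[of x y e2] s_nonzero
  by (simp_all add: g_eq H_eq p_def q_def field_simps)

lemma nabla'_coords:
  "k0 (N' x y) = - a * k0 x * k0 y - q * k0 x * k2 y - p * k2 x * k0 y"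
  "k1 (N' x y) = a * k0 x * k1 y + b * k0 x * k2 y + q * k1 x * k2 y + p * k2 x * k1 y + d * s * k2 x * k2 y"
  "k2 (N' x y) = (- b * k0 x * k0 y + q * k0 x * k1 y - q * k1 x * k0 y) / s - d * k2 x * k0 y"
  using g_nabla'[of x y e0] g_nabla'[of x y e1] g_nabla'[of x y e2] s_nonzero
  by (simp_all add: g_eq H_eq p_def q_def field_simps)

end

locale null_case = almost_abelian_einstein e0 e1 e2 k0 k1 k2 br a b c d H g f \<delta> +
    null_frame e0 e1 e2 k0 k1 k2 br a b c d H g f s
  for e0 e1 e2 :: "'a::euclidean_space" and k0 k1 k2 br a b c d H g f \<delta> s
begin

lemma c_f_zero: "c = 0" "f = 0"
proof -
  note simps = \<delta>_nabla nabla_coords nabla'_coords field_simps power2_eq_square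
  have P: "p * \<delta> (lift g e2) = p\<^sup>2 + q\<^sup>2"
    using einstein_eqs(1)[of e1 e0] s_nonzero by (simp add: simps)
  have M: "q * \<delta> (lift g' e2) = p\<^sup>2 + q\<^sup>2"
    using einstein_eqs(2)[of e1 e0] s_nonzero by (simp add: simps)
  have p1: "p * \<delta> (lift g e1) = 0"
    using einstein_eqs(1)[of e1 e2] s_nonzero by (simp add: simps)
  have q1: "q * \<delta> (lift g e1) = 0"
    using einstein_eqs(1)[of e2 e1] s_nonzero by (simp add: simps)
  have pq: "d * s * \<delta> (lift g e1) = 2 * p * q"
    using einstein_eqs(1)[of e2 e2] s_nonzero by (simp add: simps)
  \<comment> \<open>If \<open>p\<close> is non-zero, the divergence vanishes over \<open>e1\<close>
    and with it the product. So one of \<open>p\<close> and \<open>q\<close> is zero, and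
    \<open>P\<close> or \<open>M\<close> then kills the sum of their squares.\<close>
  have "p * q = 0" using p1 pq by (cases "p = 0") auto
  then have "p = 0 \<and> q = 0" using P M by auto
  then show "c = 0" "f = 0" using s_nonzero by (auto simp: p_def q_def)
qed

end

section \<open>Diagonalization\<close>

lemma eigenvector_2:
  fixes a b c d t :: real
  assumes "t\<^sup>2 - (a + d) * t + (a * d - b * c) = 0"
  obtains x y where "(x, y) \<noteq> (0, 0)" "a * x + b * y = t * x" "c * x + d * y = t * y"
proof -
  have *: "(t - a) * (t - d) = b * c"
    using assms by (simp add: power2_eq_square algebra_simps)
  show thesis
  proof (cases "b = 0 \<and> c = 0")
    case True
    then consider "t = a" | "t = d" using * by auto
    then show thesis using True that[of 1 0] that[of 0 1] by cases auto
  next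
    case False
    then consider "b \<noteq> 0" | "c \<noteq> 0" by blast
    \<comment> \<open>Up to sign the candidates are the columns of the adjugate of the matrix minus
      \<open>t\<close>.\<close>
    then show thesis
      using that[of b "t - a"] that[of "t - d" c] * by cases (auto simp: algebra_simps)
  qed
qed

lemma quadratic_roots:
  fixes a b c d :: real
  assumes "(a - d)\<^sup>2 + 4 * b * c \<ge> 0"
  defines "r \<equiv> sqrt ((a - d)\<^sup>2 + 4 * b * c)"
  shows "((a + d + r) / 2)\<^sup>2 - (a + d) * ((a + d + r) / 2) + (a * d - b * c) = 0"
    "((a + d - r) / 2)\<^sup>2 - (a + d) * ((a + d - r) / 2) + (a * d - b * c) = 0"
proof -
  have "r\<^sup>2 = (a - d)\<^sup>2 + 4 * b * c" using assms by simp
  then show "((a + d + r) / 2)\<^sup>2 - (a + d) * ((a + d + r) / 2) + (a * d - b * c) = 0"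
    "((a + d - r) / 2)\<^sup>2 - (a + d) * ((a + d - r) / 2) + (a * d - b * c) = 0"
    by (simp_all add: power2_eq_square field_simps)
qed

context almost_abelian
begin

text \<open>Pass to the frame of \<open>e0\<close> divided by \<open>\<mu>\<close> and the two
  eigenvectors; the rescaling normalizes the first eigenvalue to 1. The new coordinates come from
  Cramer's rule.\<close>

lemma lie_isomorphic_diagonal:
  assumes v: "a * x1 + b * y1 = \<mu> * x1" "c * x1 + d * y1 = \<mu> * y1"
    and w: "a * x2 + b * y2 = \<nu> * x2" "c * x2 + d * y2 = \<nu> * y2"
    and D: "x1 * y2 - x2 * y1 \<noteq> 0" and \<mu>: "\<mu> \<noteq> 0"
  shows "lie_isomorphic br (semidirect_bracket (vector [vector [1, 0], vector [0, \<nu> / \<mu>]]))"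
proof -
  define D where "D = x1 * y2 - x2 * y1"
  have D0: "D \<noteq> 0" using D by (simp add: D_def)
  \<comment> \<open>The entries of the matrix as conjugate of the diagonal one by the matrix of
    eigenvectors, cleared of the determinant \<open>D\<close>.\<close>
  have coeff: "\<mu> * x1 * y2 - \<nu> * x2 * y1 = a * D" "(\<nu> - \<mu>) * (x1 * x2) = b * D"
    "(\<mu> - \<nu>) * (y1 * y2) = c * D" "\<nu> * x1 * y2 - \<mu> * x2 * y1 = d * D"
    using v w unfolding D_def by algebra+
  define v w where "v = x1 *\<^sub>R e1 + y1 *\<^sub>R e2" and "w = x2 *\<^sub>R e1 + y2 *\<^sub>R e2"
  define l0 l1 l2 where "l0 x = \<mu> * k0 x" and "l1 x = (k1 x * y2 - k2 x * x2) / D"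
    and "l2 x = (x1 * k2 x - y1 * k1 x) / D" for x
  have lin: "linear l0" "linear l1" "linear l2"
    by (rule linearI; simp add: l0_def l1_def l2_def k_simps field_simps D0)+
  have cramer: "l1 x * x1 + l2 x * x2 = k1 x" "l1 x * y1 + l2 x * y2 = k2 x" for x
  proof -
    have "(l1 x * x1 + l2 x * x2) * D = k1 x * D" "(l1 x * y1 + l2 x * y2) * D = k2 x * D"
      using D0 unfolding l1_def l2_def by (simp_all add: field_simps) (simp_all add: D_def algebra_simps)
    then show "l1 x * x1 + l2 x * x2 = k1 x" "l1 x * y1 + l2 x * y2 = k2 x" using D0 by simp_all
  qed
  have "almost_abelian ((1 / \<mu>) *\<^sub>R e0) v w l0 l1 l2 br 1 0 0 (\<nu> / \<mu>)"
  proof (intro almost_abelian.intro basis3.intro almost_abelian_axioms.intro)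
    show "x = l0 x *\<^sub>R (1 / \<mu>) *\<^sub>R e0 + l1 x *\<^sub>R v + l2 x *\<^sub>R w" for x
      using cramer[of x] \<mu> by (intro k_eqI) (simp_all add: v_def w_def k_simps l0_def)
    have "k1 (br x y) * D = \<mu> * (k0 x * (l1 y * D) - (l1 x * D) * k0 y) * x1 +
        \<nu> * (k0 x * (l2 y * D) - (l2 x * D) * k0 y) * x2" (is ?A)
      "k2 (br x y) * D = \<mu> * (k0 x * (l1 y * D) - (l1 x * D) * k0 y) * y1 +
        \<nu> * (k0 x * (l2 y * D) - (l2 x * D) * k0 y) * y2" (is ?B) for x y
    proof -
      have *: "l1 z * D = k1 z * y2 - k2 z * x2" "l2 z * D = x1 * k2 z - y1 * k1 z" for z
        using D0 by (simp_all add: l1_def l2_def)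
      show ?A ?B unfolding * k_br using coeff by algebra+
    qed
    then have "k1 (br x y) * D = (\<mu> * (k0 x * l1 y - l1 x * k0 y) * x1 + \<nu> * (k0 x * l2 y - l2 x * k0 y) * x2) * D"
      "k2 (br x y) * D = (\<mu> * (k0 x * l1 y - l1 x * k0 y) * y1 + \<nu> * (k0 x * l2 y - l2 x * k0 y) * y2) * D" for x y
      by (simp_all add: algebra_simps del: k_br)
    then have br_xy: "k1 (br x y) = \<mu> * (k0 x * l1 y - l1 x * k0 y) * x1 + \<nu> * (k0 x * l2 y - l2 x * k0 y) * x2"
      "k2 (br x y) = \<mu> * (k0 x * l1 y - l1 x * k0 y) * y1 + \<nu> * (k0 x * l2 y - l2 x * k0 y) * y2" for x y
      using D0 by (simp_all only: mult_cancel_right simp_thms)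
    show "br x y = (l0 x * l1 y - l1 x * l0 y) *\<^sub>R (1 *\<^sub>R v + 0 *\<^sub>R w) +
        (l0 x * l2 y - l2 x * l0 y) *\<^sub>R (0 *\<^sub>R v + (\<nu> / \<mu>) *\<^sub>R w)" for x y
      using \<mu> by (intro k_eqI) (simp_all add: br_xy v_def w_def k_simps l0_def field_simps del: k_br(2,3))
  qed (use lin D0 \<mu> in \<open>auto simp: l0_def l1_def l2_def v_def w_def k_simps D_def algebra_simps\<close>)
  then show ?thesis by (rule almost_abelian.lie_isomorphic_semidirect)
qed

text \<open>Dividing by the eigenvalue of larger modulus puts the quotient into [-1, 1]; the value
  -1 is excluded because the eigenvalues do not sum to zero.\<close>

lemma lie_isomorphic_diagonal_exists:
  assumes disc: "(a - d)\<^sup>2 + 4 * b * c > 0 \<or> a = d \<and> b = 0 \<and> c = 0" and trace: "a + d \<noteq> 0"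
  shows "\<exists>l. -1 < l \<and> l \<le> 1 \<and>
    lie_isomorphic br (semidirect_bracket (vector [vector [1, 0], vector [0, l]]))"
proof -
  have "\<exists>\<mu> \<nu> x1 y1 x2 y2. \<mu> + \<nu> = a + d \<and> x1 * y2 - x2 * y1 \<noteq> 0 \<and>
    a * x1 + b * y1 = \<mu> * x1 \<and> c * x1 + d * y1 = \<mu> * y1 \<and>
    a * x2 + b * y2 = \<nu> * x2 \<and> c * x2 + d * y2 = \<nu> * y2"
    using disc
  proof
    assume pos: "(a - d)\<^sup>2 + 4 * b * c > 0"
    define r where "r = sqrt ((a - d)\<^sup>2 + 4 * b * c)"
    define \<mu> \<nu> where "\<mu> = (a + d + r) / 2" and "\<nu> = (a + d - r) / 2"
    have neq: "\<mu> \<noteq> \<nu>" using pos by (simp add: \<mu>_def \<nu>_def r_def)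
    have sum: "\<mu> + \<nu> = a + d" by (simp add: \<mu>_def \<nu>_def field_simps)
    have char: "\<mu>\<^sup>2 - (a + d) * \<mu> + (a * d - b * c) = 0" "\<nu>\<^sup>2 - (a + d) * \<nu> + (a * d - b * c) = 0"
      using quadratic_roots[of a d b c] pos unfolding \<mu>_def \<nu>_def r_def by simp_all
    obtain x1 y1 where v: "(x1, y1) \<noteq> (0, 0)" "a * x1 + b * y1 = \<mu> * x1" "c * x1 + d * y1 = \<mu> * y1"
      by (rule eigenvector_2[OF char(1)])
    obtain x2 y2 where w: "(x2, y2) \<noteq> (0, 0)" "a * x2 + b * y2 = \<nu> * x2" "c * x2 + d * y2 = \<nu> * y2"
      by (rule eigenvector_2[OF char(2)])
    have "x1 * y2 - x2 * y1 \<noteq> 0"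
    proof
      assume 0: "x1 * y2 - x2 * y1 = 0"
      then have "(\<mu> - \<nu>) * (x1 * x2) = 0" "(\<mu> - \<nu>) * (y1 * y2) = 0"
        using v(2,3) w(2,3) by algebra+
      then show False using neq v(1) w(1) 0 by auto
    qed
    then show ?thesis using sum v w by blast
  next
    assume "a = d \<and> b = 0 \<and> c = 0"
    then show ?thesis by (intro exI[of _ a] exI[of _ d] exI[of _ 1] exI[of _ 0]) (auto intro!: exI[of _ 1])
  qed
  then obtain \<mu> \<nu> x1 y1 x2 y2 where *: "\<mu> + \<nu> = a + d" "x1 * y2 - x2 * y1 \<noteq> 0"
    "a * x1 + b * y1 = \<mu> * x1" "c * x1 + d * y1 = \<mu> * y1"
    "a * x2 + b * y2 = \<nu> * x2" "c * x2 + d * y2 = \<nu> * y2" by blast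
  have quotient: "-1 < t / u \<and> t / u \<le> 1 \<and> u \<noteq> 0" if "\<bar>t\<bar> \<le> \<bar>u\<bar>" "u + t \<noteq> 0" for t u :: real
    using that by (auto simp: field_simps abs_if split: if_splits)
  show ?thesis
  proof (cases "\<bar>\<nu>\<bar> \<le> \<bar>\<mu>\<bar>")
    case True
    with quotient[of \<nu> \<mu>] * trace have "-1 < \<nu> / \<mu> \<and> \<nu> / \<mu> \<le> 1 \<and> \<mu> \<noteq> 0" by simp
    then show ?thesis using lie_isomorphic_diagonal[OF *(3-6,2)] by blast
  next
    case False
    with quotient[of \<mu> \<nu>] * trace have "-1 < \<mu> / \<nu> \<and> \<mu> / \<nu> \<le> 1 \<and> \<nu> \<noteq> 0" by (simp add: add.commute)
    moreover have "x2 * y1 - x1 * y2 \<noteq> 0" using *(2) by simp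
    ultimately show ?thesis using lie_isomorphic_diagonal[OF *(5,6,3,4)] by blast
  qed
qed

end

section \<open>Non-unimodular Lie algebras as semidirect products\<close>

context basis3
begin

lemma almost_abelianI:
  assumes br: "bilinear br" "\<And>x. br x x = 0"
    and "br e1 e2 = 0" "k0 (br e0 e1) = 0" "k0 (br e0 e2) = 0"
  shows "almost_abelian e0 e1 e2 k0 k1 k2 br
    (k1 (br e0 e1)) (k1 (br e0 e2)) (k2 (br e0 e1)) (k2 (br e0 e2))"
proof unfold_locales
  fix x y
  note skew = bilinear_alternating_skew[OF br(1,2)]
  have e: "br e0 e1 = k1 (br e0 e1) *\<^sub>R e1 + k2 (br e0 e1) *\<^sub>R e2"
    "br e0 e2 = k1 (br e0 e2) *\<^sub>R e1 + k2 (br e0 e2) *\<^sub>R e2"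
    using assms by (auto intro!: k_eqI simp: k_simps)
  have "br (x0 *\<^sub>R e0 + x1 *\<^sub>R e1 + x2 *\<^sub>R e2) (y0 *\<^sub>R e0 + y1 *\<^sub>R e1 + y2 *\<^sub>R e2) =
      (x0 * y1 - x1 * y0) *\<^sub>R br e0 e1 + (x0 * y2 - x2 * y0) *\<^sub>R br e0 e2" for x0 x1 x2 y0 y1 y2
    by (simp add: bilinear_ladd[OF br(1)] bilinear_radd[OF br(1)] bilinear_lmul[OF br(1)]
        bilinear_rmul[OF br(1)] br(2) skew[of e1 e0] skew[of e2 e0] skew[of e2 e1] assms(3) algebra_simps)
  from this[of "k0 x" "k1 x" "k2 x" "k0 y" "k1 y" "k2 y"]
  have "br x y = (k0 x * k1 y - k1 x * k0 y) *\<^sub>R br e0 e1 + (k0 x * k2 y - k2 x * k0 y) *\<^sub>R br e0 e2"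
    unfolding expand[symmetric] .
  then show "br x y = (k0 x * k1 y - k1 x * k0 y) *\<^sub>R (k1 (br e0 e1) *\<^sub>R e1 + k2 (br e0 e1) *\<^sub>R e2) +
    (k0 x * k2 y - k2 x * k0 y) *\<^sub>R (k1 (br e0 e2) *\<^sub>R e1 + k2 (br e0 e2) *\<^sub>R e2)"
    by (simp only: e[symmetric])
qed

end

text \<open>By the Jacobi identity the adjoint of a bracket is a commutator of endomorphisms, hence
  traceless.\<close>

lemma lie_algebra_trace:
  assumes "lie_algebra br"
  shows "linear (\<lambda>x. endo_trace UNIV (br x))" "endo_trace UNIV (br (br x y)) = 0"
proof -
  have br: "bilinear br" "br x x = 0" "br x (br y z) + br y (br z x) + br z (br x y) = 0" for x y z
    using assms by (auto simp: lie_algebra_def)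
  have lin: "linear (br x)" for x using br(1) by (simp add: bilinear_def)
  have eta: "br (x + y) = (\<lambda>z. br x z + br y z)" "br (r *\<^sub>R x) = (\<lambda>z. r *\<^sub>R br x z)" for x y r
    by (auto simp: bilinear_ladd[OF br(1)] bilinear_lmul[OF br(1)])
  show "linear (\<lambda>x. endo_trace UNIV (br x))"
    by (rule linearI) (simp_all add: eta endo_trace_add endo_trace_scaleR lin)
  note skew = bilinear_alternating_skew[OF br(1,2)]
  have "br (br x y) z = br x (br y z) - br y (br x z)" for z
    using br(3)[of x y z] skew[of z "br x y"] skew[of z x] bilinear_rneg[OF br(1), of y "br x z"]
    by (simp add: algebra_simps)
  then have "br (br x y) = (\<lambda>z. br x (br y z) - br y (br x z))" by blast
  then show "endo_trace UNIV (br (br x y)) = 0"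
    using endo_trace_commute[OF lin lin, of x y] linear_compose[OF lin lin]
    by (simp add: endo_trace_diff o_def)
qed

section \<open>Adapted frames\<close>

text \<open>Brackets lie in the kernel because their adjoints are traceless. The traces of the
  adjoints of \<open>e1\<close> and \<open>e2\<close> then reduce to the two coefficients of
  \<open>br e1 e2\<close>, so the kernel is abelian.\<close>

lemma (in basis3) almost_abelian_of_kernel:
  assumes lie: "lie_algebra br" and ker: "unimodular_kernel br = {x. k0 x = 0}"
  shows "\<exists>a b c d. almost_abelian e0 e1 e2 k0 k1 k2 br a b c d \<and> a + d \<noteq> 0"
proof -
  have br: "bilinear br" "br x x = 0" for x
    using lie by (auto simp: lie_algebra_def)
  have tr: "endo_trace UNIV (br x) = k0 (br x e0) + k1 (br x e1) + k2 (br x e2)" for x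
    using br(1) by (intro endo_trace_basis3) (simp add: bilinear_def)
  have ker: "endo_trace UNIV (br x) = 0 \<longleftrightarrow> k0 x = 0" for x
    using ker by (auto simp: unimodular_kernel_def)
  have k0: "k0 (br x y) = 0" for x y
    using lie_algebra_trace(2)[OF lie] ker by blast
  note skew = bilinear_alternating_skew[OF br, of e2 e1]
  have "br e1 e2 = 0"
    using ker[of e1] ker[of e2] unfolding tr
    by (intro k_eqI) (simp_all add: k0 br(2) skew k_simps)
  then have "almost_abelian e0 e1 e2 k0 k1 k2 br
      (k1 (br e0 e1)) (k1 (br e0 e2)) (k2 (br e0 e1)) (k2 (br e0 e2))"
    by (intro almost_abelianI br k0)
  moreover have "k1 (br e0 e1) + k2 (br e0 e2) \<noteq> 0"
    using ker[of e0] unfolding tr by (simp add: k0)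
  ultimately show ?thesis by blast
qed

section \<open>Orthogonal vectors in arbitrary signature\<close>

lemma (in gen_metric) orthogonal_pair_exists:
  assumes "DIM('a) > 2"
  obtains x where "x \<noteq> 0" "g v x = 0" "g w x = 0"
proof -
  define L where "L x = (g v x, g w x)" for x
  have lin: "linear L" by (rule linearI) (simp_all add: L_def g_simps)
  have "\<not> inj L"
  proof
    assume "inj L"
    then have "dim (range L) = DIM('a)" using dim_image_eq[OF lin, of UNIV] by simp
    moreover have "dim (range L) \<le> DIM(real \<times> real)" by (rule dim_subset_UNIV)
    ultimately show False using assms by simp
  qed
  then show thesis
    using that by (auto simp: linear_injective_0[OF lin] L_def zero_prod_def)
qed

text \<open>Polarization: the complement of \<open>n\<close> contains \<open>x\<close> and
  \<open>z\<close> with \<open>g x z \<noteq> 0\<close>, so \<open>x\<close>, \<open>z\<close> and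
  \<open>x + z\<close> cannot all be null.\<close>

lemma (in gen_metric) nonnull_orthogonal_exists:
  assumes dim: "DIM('a) > 2" and n: "g n n \<noteq> 0"
  obtains x where "g n x = 0" "g x x \<noteq> 0"
proof -
  obtain x where x: "x \<noteq> 0" "g n x = 0" using orthogonal_pair_exists[OF dim] by metis
  obtain y where y: "g x y \<noteq> 0" using g_nondeg x(1) by blast
  define z where "z = y - (g n y / g n n) *\<^sub>R n"
  have z: "g n z = 0" "g x z \<noteq> 0"
    using n x y by (simp_all add: z_def g_simps g_sym[of x n])
  have "g (x + z) (x + z) = g x x + 2 * g x z + g z z"
    by (simp add: g_simps g_sym[of z x])
  then show thesis
    using that[of x] that[of z] that[of "x + z"] x z by (cases "g x x = 0"; cases "g z z = 0") (auto simp: g_simps)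
qed

lemma (in gen_metric) metric_expand:
  assumes "basis3 e0 e1 e2 k0 k1 k2"
  shows "g x y = k0 x * (k0 y * g e0 e0 + k1 y * g e0 e1 + k2 y * g e0 e2) +
    k1 x * (k0 y * g e1 e0 + k1 y * g e1 e1 + k2 y * g e1 e2) +
    k2 x * (k0 y * g e2 e0 + k1 y * g e2 e1 + k2 y * g e2 e2)"
proof -
  interpret basis3 e0 e1 e2 k0 k1 k2 by fact
  have "g (x0 *\<^sub>R e0 + x1 *\<^sub>R e1 + x2 *\<^sub>R e2) (y0 *\<^sub>R e0 + y1 *\<^sub>R e1 + y2 *\<^sub>R e2) =
    x0 * (y0 * g e0 e0 + y1 * g e0 e1 + y2 * g e0 e2) +
    x1 * (y0 * g e1 e0 + y1 * g e1 e1 + y2 * g e1 e2) +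
    x2 * (y0 * g e2 e0 + y1 * g e2 e1 + y2 * g e2 e2)" for x0 x1 x2 y0 y1 y2
    by (simp add: g_simps algebra_simps)
  from this[of "k0 x" "k1 x" "k2 x" "k0 y" "k1 y" "k2 y"]
  show ?thesis unfolding expand[symmetric] .
qed

section \<open>Two-by-two matrices with real spectrum\<close>

lemma only_real_eigenvalues_triangular:
  "only_real_eigenvalues (vector [vector [a, b], vector [0, d]])"
  unfolding only_real_eigenvalues_def
proof (intro allI impI, elim conjE)
  fix \<mu> :: complex and v :: "complex^2"
  assume v: "v \<noteq> 0"
    and "map_matrix complex_of_real (vector [vector [a, b], vector [0, d]]) *v v = \<mu> *s v"
  then have eq: "of_real a * v $ 1 + of_real b * v $ 2 = \<mu> * v $ 1" "of_real d * v $ 2 = \<mu> * v $ 2"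
    by (simp_all add: vec_eq_iff forall_2 matrix_vector_mult_def sum_2 map_matrix_def)
  show "\<mu> \<in> \<real>"
  proof (cases "v $ 2 = 0")
    case True
    then have "v $ 1 \<noteq> 0" using v by (simp add: vec_eq_iff forall_2)
    then have "\<mu> = of_real a" using eq True by simp
    then show ?thesis by simp
  next
    case False
    then have "\<mu> = of_real d" using eq(2) by simp
    then show ?thesis by simp
  qed
qed

text \<open>The roots of the characteristic polynomial are real and sum to the non-zero trace, so
  one of them is non-zero. The existence proof divides by this eigenvalue.\<close>

lemma real_eigenvector_exists:
  fixes A :: "real^2^2"
  assumes real: "only_real_eigenvalues A" and trace: "trace A \<noteq> 0"
  obtains t v where "t \<noteq> 0" "v \<noteq> 0" "A *v v = t *\<^sub>R v"
proof -
  define a b c d where "a = A $ 1 $ 1" and "b = A $ 1 $ 2" and "c = A $ 2 $ 1" and "d = A $ 2 $ 2"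
  have tr: "a + d \<noteq> 0" using trace by (simp add: trace_def sum_2 a_def d_def)
  have disc: "(a - d)\<^sup>2 + 4 * b * c \<ge> 0"
  proof (rule ccontr)
    assume "\<not> (a - d)\<^sup>2 + 4 * b * c \<ge> 0"
    then have neg: "(a - d)\<^sup>2 + 4 * b * c < 0" by simp
    then have b: "b \<noteq> 0" by auto
    define r where "r = sqrt (- ((a - d)\<^sup>2 + 4 * b * c))"
    have r: "r \<noteq> 0" "r\<^sup>2 = - ((a - d)\<^sup>2 + 4 * b * c)" using neg by (simp_all add: r_def)
    \<comment> \<open>A negative discriminant would give this explicit non-real eigenvalue, with an
      eigenvector of the adjugate form; \<open>b \<noteq> 0\<close> makes it non-zero.\<close>
    define \<mu> where "\<mu> = Complex ((a + d) / 2) (r / 2)"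
    define v :: "complex^2" where "v = vector [of_real b, \<mu> - of_real a]"
    have "map_matrix complex_of_real A *v v = \<mu> *s v"
      using r(2)
      by (simp add: vec_eq_iff forall_2 matrix_vector_mult_def sum_2 map_matrix_def v_def \<mu>_def complex_eq_iff
          a_def[symmetric] b_def[symmetric] c_def[symmetric] d_def[symmetric] power2_eq_square field_simps)
    moreover have "v \<noteq> 0" using b by (simp add: vec_eq_iff forall_2 v_def)
    ultimately have "\<mu> \<in> \<real>" using real by (auto simp: only_real_eigenvalues_def)
    then show False using r(1) by (simp add: complex_is_Real_iff \<mu>_def)
  qed
  obtain t where t: "t \<noteq> 0" "t\<^sup>2 - (a + d) * t + (a * d - b * c) = 0"
  proof -
    define r where "r = sqrt ((a - d)\<^sup>2 + 4 * b * c)"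
    have "(a + d + r) / 2 \<noteq> 0 \<or> (a + d - r) / 2 \<noteq> 0" using tr by auto
    then show thesis using that quadratic_roots[OF disc, folded r_def] by blast
  qed
  obtain x y where xy: "(x, y) \<noteq> (0, 0)" "a * x + b * y = t * x" "c * x + d * y = t * y"
    by (rule eigenvector_2[OF t(2)])
  show thesis
  proof (rule that[OF t(1)])
    show "vector [x, y] \<noteq> (0 :: real^2)" using xy(1) by (auto simp: vec_eq_iff forall_2)
    show "A *v vector [x, y] = t *\<^sub>R vector [x, y]"
      using xy(2,3) by (simp add: vec_eq_iff forall_2 matrix_vector_mult_def sum_2 a_def b_def c_def d_def)
  qed
qed

section \<open>The two cases of the classification\<close>

proposition einstein_classification:
  fixes br :: "'a::euclidean_space \<Rightarrow> 'a \<Rightarrow> 'a"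
  assumes dim: "DIM('a) = 3" and lie: "lie_algebra br" and nonuni: "\<not> unimodular br"
    and einstein: "gen_einstein br H g \<delta>" and \<delta>: "\<delta> \<noteq> (\<lambda>_. 0)"
  shows "(nondegenerate_on (unimodular_kernel br) g \<and>
             (\<exists>l::real. -1 < l \<and> l \<le> 1 \<and>
                lie_isomorphic br (semidirect_bracket (vector [vector [1, 0], vector [0, l]]))) \<and>
             H \<noteq> (\<lambda>_ _ _. 0))
            \<or>
            (\<not> nondegenerate_on (unimodular_kernel br) g \<and>
             H = (\<lambda>_ _ _. 0) \<and>
             (\<exists>A. only_real_eigenvalues A \<and> trace A \<noteq> 0 \<and>
                lie_isomorphic br (semidirect_bracket A)))"
proof -
  interpret gen_metric br H g
    using lie einstein by unfold_locales (auto simp: lie_algebra_def gen_einstein_def)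
  obtain n where n: "\<And>x. g n x = endo_trace UNIV (br x)"
    using riesz[OF lie_algebra_trace(1)[OF lie]] by metis
  have ker: "unimodular_kernel br = {x. g n x = 0}"
    by (simp add: unimodular_kernel_def n)
  have n0: "n \<noteq> 0"
    using nonuni by (auto simp: unimodular_def ker g_simps)
  show ?thesis
  proof (cases "g n n = 0")
    case False
    \<comment> \<open>Only \<open>e1\<close> has to be chosen non-null; \<open>e2\<close> is then
      non-null because \<open>g\<close> is diagonal in the frame.\<close>
    obtain e1 where e1: "g n e1 = 0" "g e1 e1 \<noteq> 0"
      using nonnull_orthogonal_exists[OF _ False] dim by auto
    obtain e2 where e2: "e2 \<noteq> 0" "g n e2 = 0" "g e1 e2 = 0"
      using orthogonal_pair_exists[of n e1] dim by auto
    obtain k0 k1 k2 where B: "basis3 n e1 e2 k0 k1 k2"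
    proof (rule basis3_exists[OF dim])
      fix a b c assume 0: "a *\<^sub>R n + b *\<^sub>R e1 + c *\<^sub>R e2 = 0"
      have "g n (a *\<^sub>R n + b *\<^sub>R e1 + c *\<^sub>R e2) = a * g n n" "g e1 (a *\<^sub>R n + b *\<^sub>R e1 + c *\<^sub>R e2) = b * g e1 e1"
        using e1 e2 by (simp_all add: g_simps g_sym[of e1 n])
      from this[unfolded 0] have "a = 0" "b = 0" using False e1(2) by (simp_all add: g_simps)
      then show "a = 0 \<and> b = 0 \<and> c = 0" using 0 e2(1) by simp
    qed (rule that)
    interpret basis3 n e1 e2 k0 k1 k2 by fact
    have g_eq: "g x y = g n n * k0 x * k0 y + g e1 e1 * k1 x * k1 y + g e2 e2 * k2 x * k2 y" for x y
      using e1 e2 by (simp add: metric_expand[OF B, of x y] g_sym[of e1 n] g_sym[of e2 n] g_sym[of e2 e1])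
    have q2: "g e2 e2 \<noteq> 0"
    proof
      assume "g e2 e2 = 0"
      then have "g e2 y = 0" for y by (subst g_eq) simp
      then show False using g_nondeg e2(1) by blast
    qed
    have ker_k0: "unimodular_kernel br = {x. k0 x = 0}"
      unfolding ker using False by (subst g_eq) simp
    obtain a b c d where A: "almost_abelian n e1 e2 k0 k1 k2 br a b c d" and tr: "a + d \<noteq> 0"
      using almost_abelian_of_kernel[OF lie ker_k0] by blast
    interpret orthogonal_case n e1 e2 k0 k1 k2 br a b c d H g "H n e1 e2 / 2" \<delta> "g n n" "g e1 e1" "g e2 e2"
      by (intro orthogonal_case.intro almost_abelian_einstein.intro almost_abelian_metric.intro A
          orthogonal_case_axioms.intro almost_abelian_einstein_axioms.intro almost_abelian_metric_axioms.intro
          gen_metric_axioms einstein \<delta> dim tr g_eq False e1 q2 refl)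
    have "nondegenerate_on (unimodular_kernel br) g"
      unfolding nondegenerate_on_def ker_k0
    proof (intro ballI impI)
      fix x assume x: "x \<in> {x. k0 x = 0}" and 0: "\<forall>y\<in>{x. k0 x = 0}. g x y = 0"
      then have "g x e1 = 0" "g x e2 = 0" by simp_all
      then have "k1 x = 0" "k2 x = 0" using e1 q2 by (simp_all add: g_eq[of x])
      then show "x = 0" using x by (intro k_eqI) (simp_all add: k_simps)
    qed
    moreover have "H \<noteq> (\<lambda>_ _ _. 0)" using f_nonzero by auto
    ultimately show ?thesis
      using lie_isomorphic_diagonal_exists[OF diagonalizable tr] by blast
  next
    case True
    obtain z where z: "g n z \<noteq> 0" using g_nondeg n0 by blast
    \<comment> \<open>Completion of \<open>n\<close> to a hyperbolic pair: rescaling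
      \<open>z\<close> achieves \<open>g n z' = 1\<close>, and the multiple of \<open>n\<close>
      subtracted next makes \<open>e0\<close> null.\<close>
    define z' where "z' = (1 / g n z) *\<^sub>R z"
    define e0 where "e0 = z' - (g z' z' / 2) *\<^sub>R n"
    have z': "g n z' = 1" using z by (simp add: z'_def g_simps)
    have e0: "g n e0 = 1" "g e0 e0 = 0"
      using True z' by (simp_all add: e0_def g_simps g_sym[of z' n])
    obtain e2 where e2: "e2 \<noteq> 0" "g n e2 = 0" "g e0 e2 = 0"
      using orthogonal_pair_exists[of n e0] dim by auto
    obtain k0 k1 k2 where B: "basis3 e0 n e2 k0 k1 k2"
    proof (rule basis3_exists[OF dim])
      fix a b c assume 0: "a *\<^sub>R e0 + b *\<^sub>R n + c *\<^sub>R e2 = 0"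
      have "g n (a *\<^sub>R e0 + b *\<^sub>R n + c *\<^sub>R e2) = a" "g e0 (a *\<^sub>R e0 + b *\<^sub>R n + c *\<^sub>R e2) = b"
        using e0 e2 True by (simp_all add: g_simps g_sym[of e0 n])
      from this[unfolded 0] have "a = 0" "b = 0" by (simp_all add: g_simps)
      then show "a = 0 \<and> b = 0 \<and> c = 0" using 0 e2(1) by simp
    qed (rule that)
    interpret basis3 e0 n e2 k0 k1 k2 by fact
    have g_eq: "g x y = k0 x * k1 y + k1 x * k0 y + g e2 e2 * k2 x * k2 y" for x y
      using e0 e2 True
      by (simp add: metric_expand[OF B, of x y] g_sym[of e0 n] g_sym[of e2 n] g_sym[of e2 e0])
    have q2: "g e2 e2 \<noteq> 0"
    proof
      assume "g e2 e2 = 0"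
      then have "g e2 y = 0" for y by (subst g_eq) simp
      then show False using g_nondeg e2(1) by blast
    qed
    have ker_k0: "unimodular_kernel br = {x. k0 x = 0}"
      unfolding ker by (subst g_eq) simp
    obtain a b c d where A: "almost_abelian e0 n e2 k0 k1 k2 br a b c d" and tr: "a + d \<noteq> 0"
      using almost_abelian_of_kernel[OF lie ker_k0] by blast
    interpret null_case e0 n e2 k0 k1 k2 br a b c d H g "H e0 n e2 / 2" \<delta> "g e2 e2"
      by (intro null_case.intro null_frame.intro almost_abelian_einstein.intro almost_abelian_metric.intro A
          null_frame_axioms.intro almost_abelian_einstein_axioms.intro almost_abelian_metric_axioms.intro
          gen_metric_axioms einstein \<delta> dim tr g_eq q2 refl)
    \<comment> \<open>Being null, \<open>n\<close> lies in its own orthogonal complement, the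
      kernel, and spans the radical there.\<close>
    have "\<not> nondegenerate_on (unimodular_kernel br) g"
      using n0 True by (auto simp: nondegenerate_on_def ker)
    moreover have "only_real_eigenvalues (vector [vector [a, b], vector [c, d]])"
      using only_real_eigenvalues_triangular c_f_zero(1) by simp
    moreover have "trace (vector [vector [a, b], vector [c, d]] :: real^2^2) \<noteq> 0"
      using tr by (simp add: trace_def sum_2)
    ultimately show ?thesis
      using lie_isomorphic_semidirect H_zero c_f_zero by blast
  qed
qed

section \<open>Solutions for every admissible matrix\<close>

lemma (in null_frame) gen_einstein_triangular:
  assumes "c = 0" and H0: "H = (\<lambda>_ _ _. 0)" and a: "a \<noteq> 0" and dim: "DIM('a) \<ge> 2"
  shows "gen_einstein br H g (\<lambda>u. - ((a\<^sup>2 + d\<^sup>2) / a) * k0 (fst u))"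
proof -
  have pq: "p = 0" "q = 0" unfolding p_def q_def unfolding f H0 \<open>c = 0\<close> by simp_all
  have lin: "linear (\<lambda>w. N w z)" "linear (\<lambda>w. N' w z)" for z
    using nabla_bilinear gen_metric.nabla_bilinear[OF gen_metric_neg] unfolding bilinear_def by blast+
  note lins = linear_compose[OF lin(2) lin(1), unfolded o_def] linear_compose[OF lin(1) lin(2), unfolded o_def]
  have \<delta>: "linear (\<lambda>u :: 'a gen_tangent. C * k0 (fst u))" for C
    by (rule linearI) (simp_all add: k_simps algebra_simps)
  \<comment> \<open>Both sides of the equations vanish on all pairs of frame vectors except
    \<open>e0\<close>, \<open>e0\<close>. There the trace is \<open>a\<^sup>2 + d\<^sup>2\<close>
    and the \<open>e0\<close> coordinate of \<open>N e0 e0\<close> is \<open>- a\<close>, which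
    fixes the constant in the divergence.\<close>
  show ?thesis
    unfolding gen_einstein_iff[OF \<delta> dim] endo_trace_basis3[OF lins(1)] endo_trace_basis3[OF lins(2)]
    using a by (simp add: lift_apply lift'_apply nabla_coords nabla'_coords pq power2_eq_square field_simps)
qed

proposition einstein_existence:
  assumes real: "only_real_eigenvalues A" and trace: "trace A \<noteq> 0"
  shows "\<exists>H g \<delta>. gen_einstein (semidirect_bracket A) H g \<delta> \<and> \<delta> \<noteq> (\<lambda>_. 0) \<and>
               H = (\<lambda>_ _ _. 0) \<and>
               \<not> nondegenerate_on (unimodular_kernel (semidirect_bracket A)) g"
proof -
  let ?br = "semidirect_bracket A"
  obtain t v where v: "t \<noteq> 0" "v \<noteq> 0" "A *v v = t *\<^sub>R v"
    by (rule real_eigenvector_exists[OF assms])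
  define x y where "x = v $ 1" and "y = v $ 2"
  define r where "r = x\<^sup>2 + y\<^sup>2"
  have r: "r \<noteq> 0" using v(2) by (auto simp: r_def x_def y_def vec_eq_iff forall_2 sum_power2_eq_zero_iff)
  \<comment> \<open>The eigenvector turned by a right angle; \<open>v\<close> and \<open>w\<close>
    are orthogonal of squared length \<open>r\<close>, so the dual coordinates are Euclidean
    projections divided by \<open>r\<close>.\<close>
  define w :: "real^2" where "w = vector [- y, x]"
  define e0 e1 e2 :: "real \<times> (real^2)" where "e0 = (1, 0)" and "e1 = (0, v)" and "e2 = (0, w)"
  define k0 k1 k2 where "k0 u = fst u" and "k1 u = (x * snd u $ 1 + y * snd u $ 2) / r"
    and "k2 u = (x * snd u $ 2 - y * snd u $ 1) / r" for u :: "real \<times> (real^2)"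
  interpret basis3 e0 e1 e2 k0 k1 k2
  proof (rule basis3.intro)
    show "linear k0" "linear k1" "linear k2"
      by (rule linearI; simp add: k0_def k1_def k2_def add_divide_distrib diff_divide_distrib algebra_simps)+
    show "u = k0 u *\<^sub>R e0 + k1 u *\<^sub>R e1 + k2 u *\<^sub>R e2" for u
    proof -
      have "snd u $ 1 * r = (x * snd u $ 1 + y * snd u $ 2) * x - (x * snd u $ 2 - y * snd u $ 1) * y"
        "snd u $ 2 * r = (x * snd u $ 1 + y * snd u $ 2) * y + (x * snd u $ 2 - y * snd u $ 1) * x"
        by (simp_all add: r_def power2_eq_square algebra_simps)
      then show ?thesis
        using r by (intro prod_eqI) (simp_all add: k0_def k1_def k2_def e0_def e1_def e2_def w_def vec_eq_iff
            forall_2 x_def[symmetric] y_def[symmetric] field_simps)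
    qed
  qed (use r in \<open>simp_all add: k0_def k1_def k2_def e0_def e1_def e2_def w_def x_def[symmetric] y_def[symmetric]\<close>,
      simp_all add: r_def power2_eq_square algebra_simps)
  have br: "bilinear ?br" "?br u u = 0" for u
    unfolding bilinear_def semidirect_bracket_def
    by (auto intro!: linearI simp: algebra_simps matrix_vector_right_distrib scaleR_matrix_vector_assoc
        matrix_vector_mult_scaleR prod_eq_iff)
  have br_e: "?br e0 e1 = t *\<^sub>R e1" "?br e0 e2 = (0, A *v w)" "?br e1 e2 = 0"
    by (simp_all add: semidirect_bracket_def e0_def e1_def e2_def v(3) prod_eq_iff)
  \<comment> \<open>With an eigenvector as \<open>e1\<close> the matrix becomes upper triangular,
    with \<open>t\<close> and \<open>d\<close> on the diagonal.\<close>
  define b d where "b = k1 (0, A *v w)" and "d = k2 (0, A *v w)"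
  have aa: "almost_abelian e0 e1 e2 k0 k1 k2 ?br t b 0 d"
  proof -
    have "k0 (0, A *v w) = 0" by (simp add: k0_def)
    then show ?thesis
      using almost_abelianI[OF br] unfolding br_e by (simp add: k_simps b_def d_def)
  qed
  \<comment> \<open>This is the trace of \<open>A\<close>, computed in the orthogonal basis
    \<open>v\<close>, \<open>w\<close> and cleared of \<open>r\<close>.\<close>
  have tr: "t + d \<noteq> 0"
  proof -
    have "t * x = A $ 1 $ 1 * x + A $ 1 $ 2 * y" "t * y = A $ 2 $ 1 * x + A $ 2 $ 2 * y"
      using v(3) by (simp_all add: vec_eq_iff forall_2 matrix_vector_mult_def sum_2 x_def y_def)
    then have "t * r = x * (A $ 1 $ 1 * x + A $ 1 $ 2 * y) + y * (A $ 2 $ 1 * x + A $ 2 $ 2 * y)"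
      unfolding r_def by algebra
    moreover have "d * r = x * (A $ 2 $ 2 * x - A $ 2 $ 1 * y) - y * (A $ 1 $ 2 * x - A $ 1 $ 1 * y)"
      using r by (simp add: d_def k2_def w_def matrix_vector_mult_def sum_2)
    ultimately have "(t + d) * r = trace A * r"
      unfolding r_def trace_def sum_2 by (simp add: power2_eq_square algebra_simps)
    then show ?thesis using r trace by auto
  qed
  define g where "g u z = k0 u * k1 z + k1 u * k0 z + k2 u * k2 z" for u z
  define H :: "real \<times> (real^2) \<Rightarrow> real \<times> (real^2) \<Rightarrow> real \<times> (real^2) \<Rightarrow> real" where "H = (\<lambda>_ _ _. 0)"
  have "pseudo_metric g"
    unfolding pseudo_metric_def
  proof (intro conjI)
    show "bilinear g"
      unfolding bilinear_def g_def
      by (intro conjI allI linearI; simp add: k_simps algebra_simps)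
    show "nondegenerate_on UNIV g"
      unfolding nondegenerate_on_def
    proof (intro ballI impI)
      fix u assume "\<forall>z\<in>UNIV. g u z = 0"
      then have "g u e0 = 0" "g u e1 = 0" "g u e2 = 0" by blast+
      then show "u = 0" by (intro k_eqI) (simp_all add: g_def k_simps)
    qed
  qed (simp add: g_def)
  then have gm: "gen_metric ?br H g"
    using br by unfold_locales (simp_all add: H_def alternating_3form_def linear_zero)
  interpret null_frame e0 e1 e2 k0 k1 k2 ?br t b 0 d H g "H e0 e1 e2 / 2" 1
    by (intro null_frame.intro almost_abelian_metric.intro aa gm null_frame_axioms.intro
        almost_abelian_metric_axioms.intro refl) (simp_all add: g_def)
  let ?\<delta> = "\<lambda>u :: (real \<times> (real^2)) gen_tangent. - ((t\<^sup>2 + d\<^sup>2) / t) * k0 (fst u)"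
  have "gen_einstein ?br H g ?\<delta>"
    using v(1) by (intro gen_einstein_triangular) (simp_all add: H_def)
  moreover have "?\<delta> \<noteq> (\<lambda>_. 0)"
  proof
    assume "?\<delta> = (\<lambda>_. 0)"
    from fun_cong[OF this, of "(e0, 0)"] show False
      using v(1) by (simp add: sum_power2_eq_zero_iff)
  qed
  \<comment> \<open>The radical is spanned by the null vector \<open>e1\<close>: on the kernel
    \<open>k0\<close> vanishes, and \<open>g e1\<close> is \<open>k0\<close>.\<close>
  moreover have "\<not> nondegenerate_on (unimodular_kernel ?br) g"
  proof
    assume "nondegenerate_on (unimodular_kernel ?br) g"
    moreover have "e1 \<in> unimodular_kernel ?br" "\<forall>z\<in>unimodular_kernel ?br. g e1 z = 0"
      using tr by (auto simp: unimodular_kernel_eq g_def)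
    ultimately have "e1 = 0" unfolding nondegenerate_on_def by blast
    then show False using v(2) by (simp add: e1_def zero_prod_def)
  qed
  ultimately show ?thesis using H_def by blast
qed

theorem theorem1p5:
  shows "(\<forall>(br :: 'a::euclidean_space \<Rightarrow> 'a \<Rightarrow> 'a) H g \<delta>.
            DIM('a) = 3 \<and> lie_algebra br \<and> \<not> unimodular br \<and>
            gen_einstein br H g \<delta> \<and> \<delta> \<noteq> (\<lambda>_. 0) \<longrightarrow>
            (nondegenerate_on (unimodular_kernel br) g \<and>
             (\<exists>l::real. -1 < l \<and> l \<le> 1 \<and>
                lie_isomorphic br (semidirect_bracket (vector [vector [1, 0], vector [0, l]]))) \<and>
             H \<noteq> (\<lambda>_ _ _. 0))
            \<or>
            (\<not> nondegenerate_on (unimodular_kernel br) g \<and>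
             H = (\<lambda>_ _ _. 0) \<and>
             (\<exists>A. only_real_eigenvalues A \<and> trace A \<noteq> 0 \<and>
                lie_isomorphic br (semidirect_bracket A))))
         \<and>
         (\<forall>A. only_real_eigenvalues A \<and> trace A \<noteq> 0 \<longrightarrow>
            (\<exists>H g \<delta>. gen_einstein (semidirect_bracket A) H g \<delta> \<and> \<delta> \<noteq> (\<lambda>_. 0) \<and>
               H = (\<lambda>_ _ _. 0) \<and>
               \<not> nondegenerate_on (unimodular_kernel (semidirect_bracket A)) g))"
  using einstein_classification einstein_existence by blast

end
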